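(* Let $(X_k)_{k\ge1}$, $\mu$, $H=L^2(\mathbb R,\mathcal B(\mathbb R),\mu)$, $(e_j)_{j\ge1}$ and the integral $\int\Phi(h)_s\,d\Phi(g)_s$ be as defined in the context. Let $h_1,h_2\in H$ and for $t\ge0$ put $$Z_t=\int_0^t\Phi(h_1)_s\,d\Phi(h_2)_s:=\int\Phi(h_1)_s\,d\Phi\bigl(h_2\,1_{]0,t]}\bigr)_s .$$ Then the process $(Z_t)_{t}$ admits a continuous modification, i.e. there is a process $(\widetilde Z_t)_t$ on $(E,\mathcal E,\nu)$ with continuous sample paths such that $\widetilde Z_t=Z_t$ $\nu$-almost surely for every $t$.
   Context: Setting: $E$ is a normed vector space, $(E,\mathcal E,\nu)$ a probability space, and $(X_k)_{k\ge1}$ a sequence of independent, centered, variance-one real random variables on it such that for every $p>1$ there is a constant $K_p$ with $\sup_k E|X_k|^p<K_p$. $\mu$ is a diffuse (atomless) probability measure on $(\mathbb R,\mathcal B(\mathbb R))$, $H=L^2(\mathbb R,\mathcal B(\mathbb R),\mu)$ (real), with inner product $\langle\cdot,\cdot\rangle$ and Hilbert basis $(e_j)_{j\ge1}$. $H\otimes H$ is identified with $L^2(\mu\otimes\mu)$, with $(h\otimes g)(x,y)=h(x)g(y)$ and inner product also written $\langle\cdot,\cdot\rangle$. $C=\{(x,y):0\le x<y\le1\}$, $\widetilde C=\{(x,y):0\le y<x\le1\}$. For $f\in H\otimes H$, $$\varphi^{(1,1)}(f)=\sum_{j\ge2}\Bigl(\sum_{k=1}^{j-1}\langle f,e_j\otimes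 e_k\rangle X_k\Bigr)X_j,\qquad \varphi^{(2)}(f)=\sum_{j\ge1}\langle f,e_j\otimes e_j\rangle(X_j^2-1),$$ both converging in $L^2(\nu)$. Integral: for $h,g\in H$, $\int\Phi(h)_s\,d\Phi(g)_s:=\varphi^{(1,1)}(h\otimes g\,1_C+g\otimes h\,1_{\widetilde C})+\varphi^{(2)}(h\otimes g\,1_C)$. (Here $\Phi(h)=\sum_{k}\langle h,e_k\rangle X_k$ and $\Phi(h)_s=\Phi(h1_{]0,s]})$; the integral symbol is just notation for the right-hand side.) *)

theory Defs
  imports "HOL-Probability.Probability"
begin

(* Elements of the real space L^2(M) are given by square-integrable representatives. *)

definition L2_space :: "'a measure \<Rightarrow> ('a \<Rightarrow> real) set" where
  "L2_space M = {f \<in> borel_measurable M. integrable M (\<lambda>x. (f x)\<^sup>2)}"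

definition L2_inner :: "'a measure \<Rightarrow> ('a \<Rightarrow> real) \<Rightarrow> ('a \<Rightarrow> real) \<Rightarrow> real" where
  "L2_inner M f g = (\<integral>x. f x * g x \<partial>M)"

definition L2_norm :: "'a measure \<Rightarrow> ('a \<Rightarrow> real) \<Rightarrow> real" where
  "L2_norm M f = sqrt (L2_inner M f f)"

(* Membership of all S n and of Y in L^2 has to be required explicitly: the Bochner
   integral of a non-integrable function is 0, so the norm condition alone would not do. *)
definition L2_tendsto ::
  "'a measure \<Rightarrow> (nat \<Rightarrow> 'a \<Rightarrow> real) \<Rightarrow> ('a \<Rightarrow> real) \<Rightarrow> bool" where
  "L2_tendsto M S Y \<longleftrightarrow>
     (\<forall>n. S n \<in> L2_space M) \<and> Y \<in> L2_space M \<and>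
     (\<lambda>n. L2_norm M (\<lambda>x. S n x - Y x)) \<longlonglongrightarrow> 0"

(* Sequences are indexed by j \<ge> 1; the value at index 0 is never used. *)
definition hilbert_basis :: "'a measure \<Rightarrow> (nat \<Rightarrow> 'a \<Rightarrow> real) \<Rightarrow> bool" where
  "hilbert_basis M e \<longleftrightarrow>
     (\<forall>j\<ge>1. e j \<in> L2_space M) \<and>
     (\<forall>i\<ge>1. \<forall>j\<ge>1. L2_inner M (e i) (e j) = (if i = j then 1 else 0)) \<and>
     (\<forall>h\<in>L2_space M. \<forall>\<epsilon>>0. \<exists>n c.
        L2_norm M (\<lambda>x. h x - (\<Sum>j=1..n. c j * e j x)) < \<epsilon>)"

definition tensor :: "('a \<Rightarrow> real) \<Rightarrow> ('b \<Rightarrow> real) \<Rightarrow> 'a \<times> 'b \<Rightarrow> real" where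
  "tensor h g = (\<lambda>(x, y). h x * g y)"

definition triangle :: "(real \<times> real) set" where
  "triangle = {(x, y). 0 \<le> x \<and> x < y \<and> y \<le> 1}"

definition triangle' :: "(real \<times> real) set" where
  "triangle' = {(x, y). 0 \<le> y \<and> y < x \<and> x \<le> 1}"

(* The sums of the two series below are L^2 limits, hence determined only up to null
   sets; SOME picks a representative. *)

definition phi11 ::
  "'e measure \<Rightarrow> (nat \<Rightarrow> 'e \<Rightarrow> real) \<Rightarrow> real measure \<Rightarrow> (nat \<Rightarrow> real \<Rightarrow> real) \<Rightarrow>
   (real \<times> real \<Rightarrow> real) \<Rightarrow> 'e \<Rightarrow> real" where
  "phi11 \<nu> X \<mu> e f = (SOME Y. L2_tendsto \<nu>
     (\<lambda>n \<omega>. \<Sum>j=2..n.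
        (\<Sum>k=1..<j. L2_inner (\<mu> \<Otimes>\<^sub>M \<mu>) f (tensor (e j) (e k)) * X k \<omega>) * X j \<omega>) Y)"

definition phi2 ::
  "'e measure \<Rightarrow> (nat \<Rightarrow> 'e \<Rightarrow> real) \<Rightarrow> real measure \<Rightarrow> (nat \<Rightarrow> real \<Rightarrow> real) \<Rightarrow>
   (real \<times> real \<Rightarrow> real) \<Rightarrow> 'e \<Rightarrow> real" where
  "phi2 \<nu> X \<mu> e f = (SOME Y. L2_tendsto \<nu>
     (\<lambda>n \<omega>. \<Sum>j=1..n.
        L2_inner (\<mu> \<Otimes>\<^sub>M \<mu>) f (tensor (e j) (e j)) * ((X j \<omega>)\<^sup>2 - 1)) Y)"

(* The random variable written "integral of Phi(h)_s dPhi(g)_s", where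
   Phi(h) is the sum of the series of L2_inner \<mu> h (e k) * X k. *)
definition Phi_integral ::
  "'e measure \<Rightarrow> (nat \<Rightarrow> 'e \<Rightarrow> real) \<Rightarrow> real measure \<Rightarrow> (nat \<Rightarrow> real \<Rightarrow> real) \<Rightarrow>
   (real \<Rightarrow> real) \<Rightarrow> (real \<Rightarrow> real) \<Rightarrow> 'e \<Rightarrow> real" where
  "Phi_integral \<nu> X \<mu> e h g = (\<lambda>\<omega>.
     phi11 \<nu> X \<mu> e
       (\<lambda>z. tensor h g z * indicator triangle z + tensor g h z * indicator triangle' z) \<omega>
     + phi2 \<nu> X \<mu> e (\<lambda>z. tensor h g z * indicator triangle z) \<omega>)"

end

(* All series involved are martingale transforms in the independent variables X_j. If S and L depend
   only on the earlier variables and Y is a fresh centered one, then the fourth moment of S + L Y is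
   controlled by those of S and L. Iterating this bound gives E (phi f)^4 <= C |f|^4 for both
   phi^(1,1) and phi^(2), where Bessel's inequality bounds the coefficients by the norm of f.
   Linearity and |f_t - f_s|^2 <= C (G t - G s), with G t the integral of h_2^2 over ]0,t], then give
   E (Z_t - Z_s)^4 <= C (G t - G s)^2. As mu is diffuse, G is continuous, so that after the time
   change by G dyadic chaining (Kolmogorov's criterion) applies. *)

theory Submission imports Defs begin

section \<open>Square-integrable functions\<close>

text \<open>Second moments would only give E (Z_t - Z_s)^2 <= C (G t - G s), and exponent 1 is too
  small for Kolmogorov's criterion; fourth moments raise it to 2. The price is that phi^(2) is built
  from X_j^2 - 1, so eighth moments of X_j have to be bounded: the moment hypothesis enters at p =
  8. The obstacle is that phi^(1,1) and phi^(2) are versions picked by \<open>SOME\<close>. Nothing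
  is known about a picked version before the series is shown to converge in L^2, and versions
  belonging to different kernels are related only almost surely. Hence the estimates are made for
  partial sums, which are linear in the kernel, with a constant independent of the number of terms.
  An almost everywhere convergent subsequence and Fatou's lemma carry them to the difference of two
  picked versions. The same estimates on blocks of terms give the convergence. The constant survives
  the iteration because one step turns a bound c \<sigma>^2 into c (\<sigma> + \<alpha>)^2 with the
  same c, where \<alpha> is the weight of the new term.\<close>

lemma L2_spaceD:
  assumes "f \<in> L2_space M"
  shows "f \<in> borel_measurable M" "integrable M (\<lambda>x. (f x)\<^sup>2)"
  using assms by (auto simp: L2_space_def)

lemma L2_inner_self: "L2_inner M f f = (\<integral>x. (f x)\<^sup>2 \<partial>M)"
  by (simp add: L2_inner_def power2_eq_square)

lemma L2_inner_self_nonneg: "0 \<le> L2_inner M f f"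
  unfolding L2_inner_self by simp

lemma L2_space_mult_integrable:
  assumes "f \<in> L2_space M" "g \<in> L2_space M"
  shows "integrable M (\<lambda>x. f x * g x)"
proof (rule Bochner_Integration.integrable_bound)
  show "integrable M (\<lambda>x. (f x)\<^sup>2 + (g x)\<^sup>2)"
    using assms by (auto simp: L2_space_def)
  show "(\<lambda>x. f x * g x) \<in> borel_measurable M"
    using assms by (auto simp: L2_space_def)
  have "\<bar>a * b\<bar> \<le> a\<^sup>2 + b\<^sup>2" for a b :: real
  proof -
    have "2 * (\<bar>a\<bar> * \<bar>b\<bar>) \<le> a\<^sup>2 + b\<^sup>2"
      using sum_squares_bound[of "\<bar>a\<bar>" "\<bar>b\<bar>"] by simp
    moreover have "0 \<le> \<bar>a\<bar> * \<bar>b\<bar>" by simp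
    ultimately show ?thesis unfolding abs_mult by linarith
  qed
  then show "AE x in M. norm (f x * g x) \<le> norm ((f x)\<^sup>2 + (g x)\<^sup>2)"
    by simp
qed

lemma L2_space_lincomb:
  assumes "f \<in> L2_space M" "g \<in> L2_space M"
  shows "(\<lambda>x. f x + c * g x) \<in> L2_space M"
proof -
  have "integrable M (\<lambda>x. (f x)\<^sup>2 + 2 * c * (f x * g x) + c\<^sup>2 * (g x)\<^sup>2)"
    using L2_spaceD[OF assms(1)] L2_spaceD[OF assms(2)] L2_space_mult_integrable[OF assms] by auto
  then show ?thesis
    using L2_spaceD[OF assms(1)] L2_spaceD[OF assms(2)]
    by (auto simp: L2_space_def power2_sum power_mult_distrib algebra_simps)
qed

lemma L2_space_diff:
  assumes "f \<in> L2_space M" "g \<in> L2_space M"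
  shows "(\<lambda>x. f x - g x) \<in> L2_space M"
  using L2_space_lincomb[OF assms, of "-1"] by simp

lemma L2_space_add:
  assumes "f \<in> L2_space M" "g \<in> L2_space M"
  shows "(\<lambda>x. f x + g x) \<in> L2_space M"
  using L2_space_lincomb[OF assms, of 1] by simp

lemma L2_space_zero: "(\<lambda>x. 0) \<in> L2_space M"
  by (simp add: L2_space_def)

lemma L2_space_sum:
  assumes "\<And>i. i \<in> I \<Longrightarrow> u i \<in> L2_space M"
  shows "(\<lambda>x. \<Sum>i\<in>I. c i * u i x) \<in> L2_space M"
  using assms
proof (induction I rule: infinite_finite_induct)
  case (insert i I)
  have "(\<lambda>x. (\<Sum>i\<in>I. c i * u i x) + c i * u i x) \<in> L2_space M"
    by (rule L2_space_lincomb) (use insert in auto)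
  then show ?case using insert by (simp add: add.commute)
qed (auto intro: L2_space_zero)

text \<open>The squared norm of \<open>f + t * g\<close> is a nonnegative quadratic in
  \<open>t\<close>, and its value at the minimiser gives the inequality. If \<open>g\<close> has
  norm zero the quadratic is affine in \<open>t\<close>, which forces its slope to vanish.\<close>

lemma L2_Cauchy_Schwarz:
  assumes f: "f \<in> L2_space M" and g: "g \<in> L2_space M"
  shows "(L2_inner M f g)\<^sup>2 \<le> L2_inner M f f * L2_inner M g g"
proof -
  let ?A = "L2_inner M f f" and ?B = "L2_inner M f g" and ?C = "L2_inner M g g"
  have q: "0 \<le> ?A + 2 * t * ?B + t\<^sup>2 * ?C" for t
  proof -
    have "0 \<le> (\<integral>x. (f x + t * g x)\<^sup>2 \<partial>M)" by simp
    also have "\<dots> = (\<integral>x. f x * f x + 2 * t * (f x * g x) + t\<^sup>2 * (g x * g x) \<partial>M)"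
      by (rule Bochner_Integration.integral_cong) (auto simp: power2_eq_square algebra_simps)
    also have "\<dots> = ?A + 2 * t * ?B + t\<^sup>2 * ?C"
      unfolding L2_inner_def
      using L2_space_mult_integrable[OF f f] L2_space_mult_integrable[OF f g] L2_space_mult_integrable[OF g g]
      by simp
    finally show ?thesis .
  qed
  show ?thesis
  proof (cases "?C = 0")
    case True
    have "?B = 0"
    proof (rule ccontr)
      assume "?B \<noteq> 0"
      \<comment> \<open>At this \<open>t\<close> the affine function takes the value -1.\<close>
      then show False using q[of "- (?A + 1) / (2 * ?B)"] True by (simp add: field_simps)
    qed
    then show ?thesis using True by simp
  next
    case False
    then have "?C > 0" using L2_inner_self_nonneg[of M g] by linarith
    then show ?thesis using q[of "- ?B / ?C"] by (simp add: field_simps power2_eq_square)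
  qed
qed

section \<open>Fourth moments\<close>

text \<open>Measurability of \<open>f\<close> is demanded separately, since that of the fourth power
  says nothing about the sign of \<open>f\<close>.\<close>

definition L4_space :: "'a measure \<Rightarrow> ('a \<Rightarrow> real) set" where
  "L4_space M = {f \<in> borel_measurable M. integrable M (\<lambda>x. f x ^ 4)}"

lemma L4_spaceD:
  assumes "f \<in> L4_space M"
  shows "f \<in> borel_measurable M" "integrable M (\<lambda>x. f x ^ 4)"
  using assms by (auto simp: L4_space_def)

lemma L4_space_cong:
  assumes "f \<in> L4_space M" "\<And>x. g x = f x"
  shows "g \<in> L4_space M"
proof -
  have "g = f" using assms(2) by auto
  then show ?thesis using assms(1) by simp
qed

lemma L4_space_zero: "(\<lambda>x. 0) \<in> L4_space M"
  by (simp add: L4_space_def)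

text \<open>The inequality (a + b)^2 <= 2 (a^2 + b^2) is applied twice, which produces the factor
  2^2 * 2 = 8.\<close>

lemma add_pow4_le: "(a + b) ^ 4 \<le> 8 * (a ^ 4 + b ^ 4)" for a b :: real
proof -
  have "(a + b)\<^sup>2 \<le> 2 * (a\<^sup>2 + b\<^sup>2)"
    using sum_squares_bound[of a b] by (simp add: power2_sum)
  then have "((a + b)\<^sup>2)\<^sup>2 \<le> (2 * (a\<^sup>2 + b\<^sup>2))\<^sup>2"
    by (intro power_mono) auto
  also have "\<dots> \<le> 8 * ((a\<^sup>2)\<^sup>2 + (b\<^sup>2)\<^sup>2)"
    using sum_squares_bound[of "a\<^sup>2" "b\<^sup>2"] by (simp add: power2_sum power_mult_distrib algebra_simps)
  finally show ?thesis by (simp flip: power_mult)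
qed

lemma L4_space_add:
  assumes "f \<in> L4_space M" "g \<in> L4_space M"
  shows "(\<lambda>x. f x + g x) \<in> L4_space M"
proof -
  note D = L4_spaceD[OF assms(1)] L4_spaceD[OF assms(2)]
  have "integrable M (\<lambda>x. (f x + g x) ^ 4)"
  proof (rule Bochner_Integration.integrable_bound)
    show "integrable M (\<lambda>x. 8 * (f x ^ 4 + g x ^ 4))" using D by auto
    show "(\<lambda>x. (f x + g x) ^ 4) \<in> borel_measurable M" using D by auto
    show "AE x in M. norm ((f x + g x) ^ 4) \<le> norm (8 * (f x ^ 4 + g x ^ 4))"
      by (rule AE_I2) (use add_pow4_le in auto)
  qed
  then show ?thesis using D by (auto simp: L4_space_def)
qed

lemma L4_space_uminus:
  "f \<in> L4_space M \<Longrightarrow> (\<lambda>x. - f x) \<in> L4_space M"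
  by (auto simp: L4_space_def)

lemma L4_space_diff:
  assumes "f \<in> L4_space M" "g \<in> L4_space M"
  shows "(\<lambda>x. f x - g x) \<in> L4_space M"
  using L4_space_add[OF assms(1) L4_space_uminus[OF assms(2)]] by simp

lemma L4_space_square: "f \<in> L4_space M \<Longrightarrow> (\<lambda>x. (f x)\<^sup>2) \<in> L2_space M"
  by (auto simp: L4_space_def L2_space_def simp flip: power_mult)

text \<open>Cauchy-Schwarz against the constant function 1, which has norm one under a probability
  measure.\<close>

lemma (in prob_space) integral_square_le_L2:
  assumes "f \<in> L2_space M"
  shows "integrable M f" "(\<integral>x. f x \<partial>M)\<^sup>2 \<le> (\<integral>x. (f x)\<^sup>2 \<partial>M)"
proof -
  have one: "(\<lambda>x. 1) \<in> L2_space M" by (simp add: L2_space_def)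
  show "integrable M f" using L2_space_mult_integrable[OF assms one] by simp
  show "(\<integral>x. f x \<partial>M)\<^sup>2 \<le> (\<integral>x. (f x)\<^sup>2 \<partial>M)"
    using L2_Cauchy_Schwarz[OF assms one] by (simp add: L2_inner_def power2_eq_square prob_space)
qed

lemma (in prob_space) L4_space_subset_L2:
  assumes "f \<in> L4_space M"
  shows "f \<in> L2_space M" "(\<integral>x. (f x)\<^sup>2 \<partial>M)\<^sup>2 \<le> (\<integral>x. f x ^ 4 \<partial>M)"
  using integral_square_le_L2[OF L4_space_square[OF assms]] L4_spaceD[OF assms]
  by (auto simp: L2_space_def simp flip: power_mult)

section \<open>Fourth moments of martingale transforms\<close>

text \<open>The term linear in \<open>y\<close> is kept because it will have mean zero. The cubic
  term \<open>4 * s * (l * y) ^ 3\<close> has no sign and no vanishing mean, so it is split by 2ab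
  <= a^2 + b^2 into the two even terms; this raises their coefficients from 6 and 1 to 8 and
  3.\<close>

lemma pow4_expansion_le:
  "(s + l * y) ^ 4 \<le> s ^ 4 + 4 * (s ^ 3 * l * y) + 8 * ((s * l)\<^sup>2 * y\<^sup>2) + 3 * (l ^ 4 * y ^ 4)"
  for s l y :: real
proof -
  have "0 \<le> 2 * (s * (l * y) - (l * y)\<^sup>2)\<^sup>2" by simp
  also have "\<dots> = s ^ 4 + 4 * (s ^ 3 * l * y) + 8 * ((s * l)\<^sup>2 * y\<^sup>2) + 3 * (l ^ 4 * y ^ 4) - (s + l * y) ^ 4"
    by (simp add: power2_eq_square power4_eq_xxxx power3_eq_cube algebra_simps)
  finally show ?thesis by simp
qed

text \<open>Supplies the integrable majorant for the linear term of the expansion, from the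
  factorisation of \<open>s ^ 3 * l\<close> into \<open>s ^ 2\<close> and
  \<open>s * l\<close>.\<close>

lemma abs_cube_mult_le: "\<bar>s ^ 3 * l\<bar> \<le> s ^ 4 + (s * l)\<^sup>2" for s l :: real
proof -
  have "2 * (s\<^sup>2 * \<bar>s * l\<bar>) \<le> (s\<^sup>2)\<^sup>2 + \<bar>s * l\<bar>\<^sup>2"
    using sum_squares_bound[of "s\<^sup>2" "\<bar>s * l\<bar>"] by simp
  moreover have "s\<^sup>2 * \<bar>s * l\<bar> = \<bar>s ^ 3 * l\<bar>" by (simp add: abs_mult power3_eq_cube power2_eq_square)
  ultimately show ?thesis using abs_ge_zero[of "s ^ 3 * l"] by (simp flip: power_mult)
qed

text \<open>The constant \<open>16 * K\<^sup>2 * B\<close> is the one for which the cross term \<open>8 * \<integral>(S L)\<^sup>2 Y\<^sup>2\<close>,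
  estimated by Cauchy--Schwarz, is exactly absorbed by the mixed term of \<open>(\<sigma> + \<alpha>)\<^sup>2\<close>.\<close>

lemma (in prob_space) fourth_moment_step:
  fixes F G y :: "'b \<Rightarrow> real" and N N' :: "'b measure"
  assumes ind: "indep_var N U N' V"
    and F: "F \<in> borel_measurable N" and G: "G \<in> borel_measurable N"
    and y: "y \<in> borel_measurable N'"
    and S: "(\<lambda>\<omega>. F (U \<omega>)) \<in> L4_space M" and L: "(\<lambda>\<omega>. G (U \<omega>)) \<in> L4_space M"
    and Y: "(\<lambda>\<omega>. y (V \<omega>)) \<in> L4_space M"
    and ES: "(\<integral>\<omega>. F (U \<omega>) ^ 4 \<partial>M) \<le> 16 * K\<^sup>2 * B * \<sigma>\<^sup>2"
    and EL: "(\<integral>\<omega>. G (U \<omega>) ^ 4 \<partial>M) \<le> B * \<alpha>\<^sup>2"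
    and EY: "(\<integral>\<omega>. y (V \<omega>) \<partial>M) = 0" and EY4: "(\<integral>\<omega>. y (V \<omega>) ^ 4 \<partial>M) \<le> K"
    and pos: "K \<ge> 1" "B \<ge> 0" "\<sigma> \<ge> 0" "\<alpha> \<ge> 0"
  shows "(\<lambda>\<omega>. F (U \<omega>) + G (U \<omega>) * y (V \<omega>)) \<in> L4_space M"
    and "(\<integral>\<omega>. (F (U \<omega>) + G (U \<omega>) * y (V \<omega>)) ^ 4 \<partial>M) \<le> 16 * K\<^sup>2 * B * (\<sigma> + \<alpha>)\<^sup>2"
proof -
  define s l where "s = (\<lambda>\<omega>. F (U \<omega>))" and "l = (\<lambda>\<omega>. G (U \<omega>))"
  define Y where "Y = (\<lambda>\<omega>. y (V \<omega>))"
  note Y = Y[folded Y_def]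
  have EY: "(\<integral>\<omega>. Y \<omega> \<partial>M) = 0" and EY4: "(\<integral>\<omega>. Y \<omega> ^ 4 \<partial>M) \<le> K"
    using EY EY4 unfolding Y_def by auto
  note S' = S[folded s_def] and L' = L[folded l_def]
  note ms[measurable] = L4_spaceD(1)[OF S'] L4_spaceD(1)[OF L'] L4_spaceD(1)[OF Y]
  have ind': "indep_var borel (\<lambda>\<omega>. P (U \<omega>)) borel (\<lambda>\<omega>. Q (Y \<omega>))"
    if "P \<in> borel_measurable N" "Q \<in> borel_measurable borel" for P Q :: "_ \<Rightarrow> real"
    using indep_var_compose[OF ind that(1) measurable_compose[OF y that(2)]] by (simp add: comp_def Y_def)
  have sl2: "integrable M (\<lambda>\<omega>. (s \<omega> * l \<omega>)\<^sup>2)"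
    using L2_space_mult_integrable[OF L4_space_square[OF S'] L4_space_square[OF L']]
    by (simp add: power_mult_distrib)
  have s3l: "integrable M (\<lambda>\<omega>. s \<omega> ^ 3 * l \<omega>)"
  proof (rule Bochner_Integration.integrable_bound)
    show "integrable M (\<lambda>\<omega>. s \<omega> ^ 4 + (s \<omega> * l \<omega>)\<^sup>2)"
      using sl2 L4_spaceD(2)[OF S'] by auto
    show "AE x in M. norm (s x ^ 3 * l x) \<le> norm (s x ^ 4 + (s x * l x)\<^sup>2)"
    proof (rule AE_I2)
      fix x
      have "\<bar>s x ^ 4 + (s x * l x)\<^sup>2\<bar> = s x ^ 4 + (s x * l x)\<^sup>2" by (intro abs_of_nonneg) auto
      then show "norm (s x ^ 3 * l x) \<le> norm (s x ^ 4 + (s x * l x)\<^sup>2)"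
        using abs_cube_mult_le[of "s x" "l x"] by simp
    qed
  qed measurable
  have Y1: "integrable M Y" and Y2: "integrable M (\<lambda>\<omega>. (Y \<omega>)\<^sup>2)" and EY2: "(\<integral>\<omega>. (Y \<omega>)\<^sup>2 \<partial>M) \<le> K"
  proof -
    note a = L4_space_subset_L2[OF Y]
    show "integrable M Y" using integral_square_le_L2(1)[OF a(1)] .
    show "integrable M (\<lambda>\<omega>. (Y \<omega>)\<^sup>2)" using a(1) by (rule L2_spaceD)
    have "(\<integral>\<omega>. (Y \<omega>)\<^sup>2 \<partial>M)\<^sup>2 \<le> K" using a(2) EY4 by linarith
    \<comment> \<open>\<open>K >= 1\<close> allows the second moment to be bounded by
      \<open>K\<close> itself, so that one constant serves both moments.\<close>
    also have "\<dots> \<le> K\<^sup>2" using pos(1) by (simp add: power2_eq_square)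
    finally show "(\<integral>\<omega>. (Y \<omega>)\<^sup>2 \<partial>M) \<le> K" by (rule power2_le_imp_le) (use pos in auto)
  qed
  have FG: "(\<lambda>x. F x ^ 3 * G x) \<in> borel_measurable N" "(\<lambda>x. (F x * G x)\<^sup>2) \<in> borel_measurable N"
      "(\<lambda>x. G x ^ 4) \<in> borel_measurable N"
    using F G by measurable
  have m: "(\<lambda>y::real. y) \<in> borel_measurable borel" "(\<lambda>y::real. y\<^sup>2) \<in> borel_measurable borel"
      "(\<lambda>y::real. y ^ 4) \<in> borel_measurable borel"
    by measurable
  note d1 = ind'[OF FG(1) m(1), unfolded s_def[THEN fun_cong, symmetric] l_def[THEN fun_cong, symmetric]]
  note d2 = ind'[OF FG(2) m(2), unfolded s_def[THEN fun_cong, symmetric] l_def[THEN fun_cong, symmetric]]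
  note d4 = ind'[OF FG(3) m(3), unfolded s_def[THEN fun_cong, symmetric] l_def[THEN fun_cong, symmetric]]
  have i1: "integrable M (\<lambda>\<omega>. s \<omega> ^ 3 * l \<omega> * Y \<omega>)"
    by (rule indep_var_integrable[OF d1 s3l Y1])
  \<comment> \<open>The only use of centering: \<open>s ^ 3 * l\<close> depends on \<open>U\<close>
    alone, so the expectation factors and the mean of \<open>Y\<close> appears.\<close>
  have i1': "(\<integral>\<omega>. s \<omega> ^ 3 * l \<omega> * Y \<omega> \<partial>M) = 0"
    by (subst indep_var_lebesgue_integral[OF d1 s3l Y1]) (simp add: EY)
  have i2: "integrable M (\<lambda>\<omega>. (s \<omega> * l \<omega>)\<^sup>2 * (Y \<omega>)\<^sup>2)"
     "(\<integral>\<omega>. (s \<omega> * l \<omega>)\<^sup>2 * (Y \<omega>)\<^sup>2 \<partial>M) = (\<integral>\<omega>. (s \<omega> * l \<omega>)\<^sup>2 \<partial>M) * (\<integral>\<omega>. (Y \<omega>)\<^sup>2 \<partial>M)"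
    by (rule indep_var_integrable[OF d2 sl2 Y2] indep_var_lebesgue_integral[OF d2 sl2 Y2])+
  have i4: "integrable M (\<lambda>\<omega>. l \<omega> ^ 4 * Y \<omega> ^ 4)"
     "(\<integral>\<omega>. l \<omega> ^ 4 * Y \<omega> ^ 4 \<partial>M) = (\<integral>\<omega>. l \<omega> ^ 4 \<partial>M) * (\<integral>\<omega>. Y \<omega> ^ 4 \<partial>M)"
    by (rule indep_var_integrable[OF d4 L4_spaceD(2)[OF L'] L4_spaceD(2)[OF Y]]
         indep_var_lebesgue_integral[OF d4 L4_spaceD(2)[OF L'] L4_spaceD(2)[OF Y]])+
  have "(\<integral>\<omega>. (s \<omega> * l \<omega>)\<^sup>2 \<partial>M)\<^sup>2 \<le> (\<integral>\<omega>. s \<omega> ^ 4 \<partial>M) * (\<integral>\<omega>. l \<omega> ^ 4 \<partial>M)"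
    using L2_Cauchy_Schwarz[OF L4_space_square[OF S'] L4_space_square[OF L']]
    unfolding L2_inner_def by (simp add: power_mult_distrib flip: power_add)
  also have "\<dots> \<le> (16 * K\<^sup>2 * B * \<sigma>\<^sup>2) * (B * \<alpha>\<^sup>2)"
    using ES EL pos unfolding s_def l_def by (intro mult_mono) auto
  also have "\<dots> = (4 * K * B * \<sigma> * \<alpha>)\<^sup>2" by (simp add: power2_eq_square)
  finally have sl: "(\<integral>\<omega>. (s \<omega> * l \<omega>)\<^sup>2 \<partial>M) \<le> 4 * K * B * \<sigma> * \<alpha>"
    by (rule power2_le_imp_le) (use pos in auto)
  have iR: "integrable M (\<lambda>\<omega>. s \<omega> ^ 4 + 4 * (s \<omega> ^ 3 * l \<omega> * Y \<omega>) + 8 * ((s \<omega> * l \<omega>)\<^sup>2 * (Y \<omega>)\<^sup>2) + 3 * (l \<omega> ^ 4 * Y \<omega> ^ 4))"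
    using i1 i1' i2 i4 L4_spaceD(2)[OF S'] by auto
  have iL: "integrable M (\<lambda>\<omega>. (s \<omega> + l \<omega> * Y \<omega>) ^ 4)"
  proof (rule Bochner_Integration.integrable_bound[OF iR])
    show "AE \<omega> in M. norm ((s \<omega> + l \<omega> * Y \<omega>) ^ 4) \<le>
      norm (s \<omega> ^ 4 + 4 * (s \<omega> ^ 3 * l \<omega> * Y \<omega>) + 8 * ((s \<omega> * l \<omega>)\<^sup>2 * (Y \<omega>)\<^sup>2) + 3 * (l \<omega> ^ 4 * Y \<omega> ^ 4))"
    proof (rule AE_I2)
      fix \<omega>
      have "0 \<le> (s \<omega> + l \<omega> * Y \<omega>) ^ 4" by simp
      then show "norm ((s \<omega> + l \<omega> * Y \<omega>) ^ 4) \<le>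
      norm (s \<omega> ^ 4 + 4 * (s \<omega> ^ 3 * l \<omega> * Y \<omega>) + 8 * ((s \<omega> * l \<omega>)\<^sup>2 * (Y \<omega>)\<^sup>2) + 3 * (l \<omega> ^ 4 * Y \<omega> ^ 4))"
        unfolding real_norm_def
        using pow4_expansion_le[of "s \<omega>" "l \<omega>" "Y \<omega>"] by linarith
    qed
  qed measurable
  then show "(\<lambda>\<omega>. F (U \<omega>) + G (U \<omega>) * y (V \<omega>)) \<in> L4_space M"
    using ms unfolding L4_space_def s_def l_def Y_def by auto
  have "(\<integral>\<omega>. (s \<omega> + l \<omega> * Y \<omega>) ^ 4 \<partial>M) \<le> (\<integral>\<omega>. s \<omega> ^ 4 + 4 * (s \<omega> ^ 3 * l \<omega> * Y \<omega>) + 8 * ((s \<omega> * l \<omega>)\<^sup>2 * (Y \<omega>)\<^sup>2) + 3 * (l \<omega> ^ 4 * Y \<omega> ^ 4) \<partial>M)"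
    by (rule integral_mono[OF iL iR]) (rule pow4_expansion_le)
  also have "\<dots> = (\<integral>\<omega>. s \<omega> ^ 4 \<partial>M) + 8 * ((\<integral>\<omega>. (s \<omega> * l \<omega>)\<^sup>2 \<partial>M) * (\<integral>\<omega>. (Y \<omega>)\<^sup>2 \<partial>M))
      + 3 * ((\<integral>\<omega>. l \<omega> ^ 4 \<partial>M) * (\<integral>\<omega>. Y \<omega> ^ 4 \<partial>M))"
    using i1 i1' i2 i4 L4_spaceD(2)[OF S'] by simp
  also have "\<dots> \<le> 16 * K\<^sup>2 * B * \<sigma>\<^sup>2 + 8 * ((4 * K * B * \<sigma> * \<alpha>) * K) + 3 * ((B * \<alpha>\<^sup>2) * K)"
    using ES EL EY2 EY4 sl pos unfolding s_def l_def
    by (intro add_mono mult_mono) auto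
  also have "3 * ((B * \<alpha>\<^sup>2) * K) \<le> 16 * K\<^sup>2 * B * \<alpha>\<^sup>2"
  proof -
    have "3 * K \<le> 16 * K\<^sup>2" using pos(1) by (simp add: power2_eq_square)
    then have "(3 * K) * (B * \<alpha>\<^sup>2) \<le> (16 * K\<^sup>2) * (B * \<alpha>\<^sup>2)"
      using pos by (intro mult_right_mono) auto
    then show ?thesis by (simp add: algebra_simps)
  qed
  finally show "(\<integral>\<omega>. (F (U \<omega>) + G (U \<omega>) * y (V \<omega>)) ^ 4 \<partial>M) \<le> 16 * K\<^sup>2 * B * (\<sigma> + \<alpha>)\<^sup>2"
    unfolding s_def l_def Y_def by (simp add: power2_sum power2_eq_square algebra_simps)
qed

text \<open>Induction on \<open>n\<close>: the past \<open>X 1, ..., X n\<close> plays the role of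
  \<open>U\<close>, the variable \<open>X (Suc n)\<close> that of \<open>V\<close>, and each step
  adds \<alpha> of the new index inside the square. The sum starts after an arbitrary
  \<open>m\<close> so that the bound also covers blocks of a series. The constant \<open>B\<close>
  of the coefficients returns as \<open>16 * K ^ 2 * B\<close>, hence the lemma can be applied to
  its own output.\<close>

lemma (in prob_space) fourth_moment_martingale_transform:
  fixes X :: "nat \<Rightarrow> 'a \<Rightarrow> real" and l :: "nat \<Rightarrow> (nat \<Rightarrow> real) \<Rightarrow> real" and y :: "real \<Rightarrow> real"
  assumes ind: "indep_vars (\<lambda>_. borel) X {1..}"
    and l: "\<And>j. j \<ge> 1 \<Longrightarrow> l j \<in> borel_measurable (PiM {1..<j} (\<lambda>_. borel))"
    and y: "y \<in> borel_measurable borel"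
    and L4: "\<And>j. j \<ge> 1 \<Longrightarrow> (\<lambda>\<omega>. l j (restrict (\<lambda>i. X i \<omega>) {1..<j})) \<in> L4_space M"
    and EL: "\<And>j. j \<ge> 1 \<Longrightarrow> (\<integral>\<omega>. l j (restrict (\<lambda>i. X i \<omega>) {1..<j}) ^ 4 \<partial>M) \<le> B * (\<alpha> j)\<^sup>2"
    and Y4: "\<And>j. j \<ge> 1 \<Longrightarrow> (\<lambda>\<omega>. y (X j \<omega>)) \<in> L4_space M"
    and EY: "\<And>j. j \<ge> 1 \<Longrightarrow> (\<integral>\<omega>. y (X j \<omega>) \<partial>M) = 0"
    and EY4: "\<And>j. j \<ge> 1 \<Longrightarrow> (\<integral>\<omega>. y (X j \<omega>) ^ 4 \<partial>M) \<le> K"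
    and pos: "K \<ge> 1" "B \<ge> 0" "\<And>j. \<alpha> j \<ge> 0"
  shows "(\<lambda>\<omega>. \<Sum>j\<in>{m<..n}. l j (restrict (\<lambda>i. X i \<omega>) {1..<j}) * y (X j \<omega>)) \<in> L4_space M \<and>
    (\<integral>\<omega>. (\<Sum>j\<in>{m<..n}. l j (restrict (\<lambda>i. X i \<omega>) {1..<j}) * y (X j \<omega>)) ^ 4 \<partial>M)
      \<le> 16 * K\<^sup>2 * B * (\<Sum>j\<in>{m<..n}. \<alpha> j)\<^sup>2"
proof (induction n)
  case 0
  then show ?case by (simp add: L4_space_zero)
next
  case (Suc n)
  show ?case
  proof (cases "m \<le> n")
    case False
    \<comment> \<open>Here \<open>m\<close> is at least \<open>Suc n\<close>, so the block is
      empty.\<close>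
    then show ?thesis by (simp add: L4_space_zero)
  next
    case True
    define U where "U = (\<lambda>\<omega>. restrict (\<lambda>i. X i \<omega>) {1..<Suc n})"
    define V where "V = (\<lambda>\<omega>. restrict (\<lambda>i. X i \<omega>) {Suc n})"
    \<comment> \<open>Independence is a statement about \<open>U\<close> and \<open>V\<close>, so
      the partial sum has to be exhibited as a measurable function of the vector \<open>U\<close>;
      the inner restriction brings the argument back to the domain of \<open>l j\<close>.\<close>
    define F where "F = (\<lambda>x::nat \<Rightarrow> real. \<Sum>j\<in>{m<..n}. l j (restrict x {1..<j}) * y (x j))"
    have ind': "indep_var (PiM {1..<Suc n} (\<lambda>_. borel)) U (PiM {Suc n} (\<lambda>_. borel)) V"
      unfolding U_def V_def by (rule indep_var_restrict[OF ind]) auto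
    have F_meas: "F \<in> borel_measurable (PiM {1..<Suc n} (\<lambda>_. borel))"
      unfolding F_def
    proof (intro borel_measurable_sum borel_measurable_times)
      fix j assume j: "j \<in> {m<..n}"
      show "(\<lambda>x. l j (restrict x {1..<j})) \<in> borel_measurable (PiM {1..<Suc n} (\<lambda>_. borel))"
        by (rule measurable_compose[OF measurable_restrict_subset l]) (use j in auto)
      show "(\<lambda>x. y (x j)) \<in> borel_measurable (PiM {1..<Suc n} (\<lambda>_. borel))"
        by (rule measurable_compose[OF _ y], rule measurable_component_singleton) (use j in auto)
    qed
    have FU: "F (U \<omega>) = (\<Sum>j\<in>{m<..n}. l j (restrict (\<lambda>i. X i \<omega>) {1..<j}) * y (X j \<omega>))" for \<omega>
      unfolding F_def U_def
      by (intro sum.cong refl arg_cong2[where f="(*)"] arg_cong[where f="l _"] arg_cong[where f=y])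
         (auto simp: fun_eq_iff restrict_def)
    have V: "y (V \<omega> (Suc n)) = y (X (Suc n) \<omega>)" for \<omega>
      by (simp add: V_def)
    have y': "(\<lambda>x. y (x (Suc n))) \<in> borel_measurable (PiM {Suc n} (\<lambda>_. borel))"
      by (rule measurable_compose[OF _ y], rule measurable_component_singleton) auto
    have ss: "(\<Sum>j\<in>{m<..Suc n}. f j) = (\<Sum>j\<in>{m<..n}. f j) + f (Suc n)" for f :: "nat \<Rightarrow> real"
    proof -
      have "{m<..Suc n} = insert (Suc n) {m<..n}" using True by auto
      then show ?thesis by (simp add: add.commute)
    qed
    have *: "(\<lambda>\<omega>. F (U \<omega>)) \<in> L4_space M" "(\<lambda>\<omega>. l (Suc n) (U \<omega>)) \<in> L4_space M"
      "(\<lambda>\<omega>. y (V \<omega> (Suc n))) \<in> L4_space M"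
      "(\<integral>\<omega>. F (U \<omega>) ^ 4 \<partial>M) \<le> 16 * K\<^sup>2 * B * (\<Sum>j\<in>{m<..n}. \<alpha> j)\<^sup>2"
      "(\<integral>\<omega>. l (Suc n) (U \<omega>) ^ 4 \<partial>M) \<le> B * (\<alpha> (Suc n))\<^sup>2"
      "(\<integral>\<omega>. y (V \<omega> (Suc n)) \<partial>M) = 0" "(\<integral>\<omega>. y (V \<omega> (Suc n)) ^ 4 \<partial>M) \<le> K"
      unfolding FU V
      using Suc.IH L4[of "Suc n"] EL[of "Suc n"] Y4[of "Suc n"] EY[of "Suc n"] EY4[of "Suc n"]
      by (simp_all only: U_def)
    have \<sigma>: "(\<Sum>j\<in>{m<..n}. \<alpha> j) \<ge> 0" using pos(3) by (rule sum_nonneg)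
    have lS: "l (Suc n) \<in> borel_measurable (PiM {1..<Suc n} (\<lambda>_. borel))"
      by (rule l) simp
    note step = fourth_moment_step[OF ind' F_meas lS y', OF * pos(1,2) \<sigma> pos(3)]
    show ?thesis
      using step unfolding ss FU V unfolding U_def by simp
  qed
qed

lemma (in finite_measure) L4_space_const: "(\<lambda>x. c) \<in> L4_space M"
  by (simp add: L4_space_def)

text \<open>The coefficients are deterministic, so \<open>B = 1\<close> and the weight of index
  \<open>j\<close> is the square of \<open>a j\<close>. The function \<open>y\<close> is kept
  general because it will be both the identity and \<open>x ^ 2 - 1\<close>.\<close>

lemma (in prob_space) fourth_moment_linear:
  fixes X :: "nat \<Rightarrow> 'a \<Rightarrow> real" and y :: "real \<Rightarrow> real"
  assumes ind: "indep_vars (\<lambda>_. borel) X {1..}"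
    and y: "y \<in> borel_measurable borel"
    and Y4: "\<And>j. j \<ge> 1 \<Longrightarrow> (\<lambda>\<omega>. y (X j \<omega>)) \<in> L4_space M"
    and EY: "\<And>j. j \<ge> 1 \<Longrightarrow> (\<integral>\<omega>. y (X j \<omega>) \<partial>M) = 0"
    and EY4: "\<And>j. j \<ge> 1 \<Longrightarrow> (\<integral>\<omega>. y (X j \<omega>) ^ 4 \<partial>M) \<le> K"
    and K: "K \<ge> 1"
  shows "(\<lambda>\<omega>. \<Sum>j\<in>{m<..n}. a j * y (X j \<omega>)) \<in> L4_space M"
    "(\<integral>\<omega>. (\<Sum>j\<in>{m<..n}. a j * y (X j \<omega>)) ^ 4 \<partial>M) \<le> 16 * K\<^sup>2 * (\<Sum>j\<in>{m<..n}. (a j)\<^sup>2)\<^sup>2"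
proof -
  have "(\<integral>\<omega>. a j ^ 4 \<partial>M) \<le> 1 * ((a j)\<^sup>2)\<^sup>2" for j
    by (simp add: prob_space flip: power_mult)
  from fourth_moment_martingale_transform[where l="\<lambda>j x. a j", OF ind _ y _ this Y4 EY EY4 K]
  have "(\<lambda>\<omega>. \<Sum>j\<in>{m<..n}. a j * y (X j \<omega>)) \<in> L4_space M \<and>
    (\<integral>\<omega>. (\<Sum>j\<in>{m<..n}. a j * y (X j \<omega>)) ^ 4 \<partial>M) \<le> 16 * K\<^sup>2 * 1 * (\<Sum>j\<in>{m<..n}. (a j)\<^sup>2)\<^sup>2"
    by (simp only: L4_space_const borel_measurable_const zero_le_one zero_le_power2)
  then show "(\<lambda>\<omega>. \<Sum>j\<in>{m<..n}. a j * y (X j \<omega>)) \<in> L4_space M"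
    "(\<integral>\<omega>. (\<Sum>j\<in>{m<..n}. a j * y (X j \<omega>)) ^ 4 \<partial>M) \<le> 16 * K\<^sup>2 * (\<Sum>j\<in>{m<..n}. (a j)\<^sup>2)\<^sup>2"
    by simp_all
qed

text \<open>The inner sum is a linear form in the earlier variables, with fourth moment at most
  \<open>16 * K ^ 2\<close> times the square of its coefficient energy. Used as \<open>B\<close> in
  the transform bound, this factor appears a second time and gives 256 = 16 * 16.\<close>

lemma (in prob_space) fourth_moment_quadratic:
  fixes X :: "nat \<Rightarrow> 'a \<Rightarrow> real"
  assumes ind: "indep_vars (\<lambda>_. borel) X {1..}"
    and X4: "\<And>j. j \<ge> 1 \<Longrightarrow> X j \<in> L4_space M"
    and EX: "\<And>j. j \<ge> 1 \<Longrightarrow> (\<integral>\<omega>. X j \<omega> \<partial>M) = 0"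
    and EX4: "\<And>j. j \<ge> 1 \<Longrightarrow> (\<integral>\<omega>. X j \<omega> ^ 4 \<partial>M) \<le> K"
    and K: "K \<ge> 1"
  shows "(\<lambda>\<omega>. \<Sum>j\<in>{m<..n}. (\<Sum>k=1..<j. a j k * X k \<omega>) * X j \<omega>) \<in> L4_space M" (is ?L4)
    "(\<integral>\<omega>. (\<Sum>j\<in>{m<..n}. (\<Sum>k=1..<j. a j k * X k \<omega>) * X j \<omega>) ^ 4 \<partial>M)
      \<le> 256 * K ^ 4 * (\<Sum>j\<in>{m<..n}. \<Sum>k=1..<j. (a j k)\<^sup>2)\<^sup>2" (is ?E)
proof -
  define l where "l j x = (\<Sum>k=1..<j. a j k * x k)" for j and x :: "nat \<Rightarrow> real"
  have l: "l j \<in> borel_measurable (PiM {1..<j} (\<lambda>_. borel))" for j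
    unfolding l_def by (intro borel_measurable_sum borel_measurable_times) auto
  have lX: "l j (restrict (\<lambda>i. X i \<omega>) {1..<j}) = (\<Sum>k=1..<j. a j k * X k \<omega>)" for j \<omega>
    unfolding l_def by (intro sum.cong) auto
  \<comment> \<open>Truncated subtraction is harmless: for \<open>j = 0\<close> both intervals are
    empty.\<close>
  have iv: "{1..<j} = {0<..j-1}" for j :: nat by auto
  have lin: "(\<lambda>\<omega>. \<Sum>k=1..<j. a j k * X k \<omega>) \<in> L4_space M"
    "(\<integral>\<omega>. (\<Sum>k=1..<j. a j k * X k \<omega>) ^ 4 \<partial>M) \<le> 16 * K\<^sup>2 * (\<Sum>k=1..<j. (a j k)\<^sup>2)\<^sup>2" for j
    unfolding iv by (rule fourth_moment_linear[OF ind, of "\<lambda>x. x"]; use X4 EX EX4 K in simp)+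
  have "?L4 \<and> (\<integral>\<omega>. (\<Sum>j\<in>{m<..n}. (\<Sum>k=1..<j. a j k * X k \<omega>) * X j \<omega>) ^ 4 \<partial>M)
      \<le> 16 * K\<^sup>2 * (16 * K\<^sup>2) * (\<Sum>j\<in>{m<..n}. \<Sum>k=1..<j. (a j k)\<^sup>2)\<^sup>2"
    by (rule fourth_moment_martingale_transform[OF ind, of l "\<lambda>x. x", unfolded lX])
       (use l X4 EX EX4 K lin in \<open>simp_all add: sum_nonneg\<close>)
  moreover have "16 * K\<^sup>2 * (16 * K\<^sup>2) = 256 * K ^ 4"
    by (simp add: power2_eq_square power4_eq_xxxx)
  ultimately show ?L4 ?E by simp_all
qed

section \<open>Limits of random series with bounded fourth moments\<close>

text \<open>Fatou's lemma is applied to nonnegative integrals because integrability of the limit is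
  part of the conclusion.\<close>

lemma fourth_moment_Fatou:
  fixes f :: "nat \<Rightarrow> 'a \<Rightarrow> real"
  assumes f: "\<And>n. f n \<in> L4_space M" and g[measurable]: "g \<in> borel_measurable M"
    and lim: "AE x in M. (\<lambda>n. f n x) \<longlonglongrightarrow> g x"
    and le: "\<And>n. n \<ge> N \<Longrightarrow> (\<integral>x. f n x ^ 4 \<partial>M) \<le> c"
  shows "g \<in> L4_space M" "(\<integral>x. g x ^ 4 \<partial>M) \<le> c"
proof -
  note [measurable] = L4_spaceD(1)[OF f]
  \<comment> \<open>\<open>ennreal\<close> sends negative reals to 0, so returning to real integrals
    requires the sign of \<open>c\<close>.\<close>
  have c: "0 \<le> c"
  proof -
    have "0 \<le> (\<integral>x. f N x ^ 4 \<partial>M)" by simp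
    with le[of N] show ?thesis by linarith
  qed
  have "(\<integral>\<^sup>+x. ennreal (g x ^ 4) \<partial>M) = (\<integral>\<^sup>+x. liminf (\<lambda>n. ennreal (f n x ^ 4)) \<partial>M)"
  proof (rule nn_integral_cong_AE)
    show "AE x in M. ennreal (g x ^ 4) = liminf (\<lambda>n. ennreal (f n x ^ 4))"
      using lim
    proof eventually_elim
      case (elim x)
      then have "(\<lambda>n. ennreal (f n x ^ 4)) \<longlonglongrightarrow> ennreal (g x ^ 4)"
        by (intro tendsto_ennrealI tendsto_power)
      then show ?case by (rule lim_imp_Liminf[OF sequentially_bot, symmetric])
    qed
  qed
  also have "\<dots> \<le> liminf (\<lambda>n. \<integral>\<^sup>+x. ennreal (f n x ^ 4) \<partial>M)"
    by (rule nn_integral_liminf) measurable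
  also have "\<dots> = liminf (\<lambda>n. ennreal (\<integral>x. f n x ^ 4 \<partial>M))"
    by (subst nn_integral_eq_integral) (use L4_spaceD(2)[OF f] in auto)
  also have "\<dots> \<le> liminf (\<lambda>n::nat. ennreal c)"
  proof (rule Liminf_mono)
    show "\<forall>\<^sub>F n in sequentially. ennreal (\<integral>x. f n x ^ 4 \<partial>M) \<le> ennreal c"
      using le unfolding eventually_sequentially by (meson ennreal_leI)
  qed
  also have "\<dots> = ennreal c" by (simp add: Liminf_const)
  finally have *: "(\<integral>\<^sup>+x. ennreal (g x ^ 4) \<partial>M) \<le> ennreal c" .
  have int: "integrable M (\<lambda>x. g x ^ 4)"
    by (rule integrableI_nonneg) (use * in \<open>auto simp: less_top[symmetric] top_unique\<close>)
  then show "g \<in> L4_space M" by (simp add: L4_space_def)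
  show "(\<integral>x. g x ^ 4 \<partial>M) \<le> c"
    using * c by (simp add: nn_integral_eq_integral[OF int])
qed

text \<open>By monotone convergence the sum of the functions has finite integral, hence is finite
  almost everywhere. In the chaining argument this takes the place of the Borel-Cantelli
  lemma.\<close>

lemma AE_summable_of_summable_integral:
  fixes f :: "nat \<Rightarrow> 'a \<Rightarrow> real"
  assumes int: "\<And>n. integrable M (f n)" and nn: "\<And>n x. 0 \<le> f n x"
    and le: "\<And>n. (\<integral>x. f n x \<partial>M) \<le> c n" and c: "summable c"
  shows "AE x in M. summable (\<lambda>n. f n x)"
proof -
  have c0: "0 \<le> c n" for n
  proof -
    have "0 \<le> (\<integral>x. f n x \<partial>M)" using nn by simp
    with le[of n] show ?thesis by linarith
  qed
  have [measurable]: "f n \<in> borel_measurable M" for n using int by auto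
  have "(\<integral>\<^sup>+x. (\<Sum>n. ennreal (f n x)) \<partial>M) = (\<Sum>n. \<integral>\<^sup>+x. ennreal (f n x) \<partial>M)"
    by (rule nn_integral_suminf) measurable
  also have "\<dots> \<le> (\<Sum>n. ennreal (c n))"
    by (rule suminf_le) (auto simp: nn_integral_eq_integral[OF int] nn intro!: ennreal_leI le)
  also have "\<dots> < \<infinity>" by (simp add: suminf_ennreal2[OF c0 c])
  finally have "AE x in M. (\<Sum>n. ennreal (f n x)) \<noteq> \<infinity>"
    by (intro nn_integral_noteq_infinite) auto
  then show ?thesis
    by eventually_elim (use nn in \<open>auto intro: summable_suminf_not_top\<close>)
qed

text \<open>The L^p norms of a probability space increase with p; two applications of Cauchy-Schwarz
  lead from 4 to 2 and from 2 to 1. Writing the bound as \<open>c ^ 4\<close> avoids roots.\<close>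

lemma (in prob_space) abs_integral_le_fourth_moment:
  assumes "f \<in> L4_space M" "(\<integral>x. f x ^ 4 \<partial>M) \<le> c ^ 4" "0 \<le> c"
  shows "(\<integral>x. \<bar>f x\<bar> \<partial>M) \<le> c" "(\<integral>x. (f x)\<^sup>2 \<partial>M) \<le> c\<^sup>2"
proof -
  have "(\<integral>x. (f x)\<^sup>2 \<partial>M)\<^sup>2 \<le> (c\<^sup>2)\<^sup>2"
    using L4_space_subset_L2(2)[OF assms(1)] assms(2) by simp
  then show *: "(\<integral>x. (f x)\<^sup>2 \<partial>M) \<le> c\<^sup>2" by (rule power2_le_imp_le) simp
  have "(\<lambda>x. \<bar>f x\<bar>) \<in> L2_space M"
    using L4_space_subset_L2(1)[OF assms(1)] by (auto simp: L2_space_def)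
  from integral_square_le_L2(2)[OF this] * have "(\<integral>x. \<bar>f x\<bar> \<partial>M)\<^sup>2 \<le> c\<^sup>2" by simp
  then show "(\<integral>x. \<bar>f x\<bar> \<partial>M) \<le> c" by (rule power2_le_imp_le) fact
qed

text \<open>A sequence that is Cauchy in L^4 is Cauchy in L^1, so a subsequence converges almost
  everywhere. Fatou's lemma along that subsequence estimates the distance of \<open>s n\<close> to
  its limit in L^4, hence in L^2.\<close>

lemma (in prob_space) L2_limit_exists:
  fixes s :: "nat \<Rightarrow> 'a \<Rightarrow> real"
  assumes s: "\<And>n. s n \<in> L4_space M"
    and Cauchy: "\<And>\<epsilon>. \<epsilon> > 0 \<Longrightarrow> \<exists>N. \<forall>i\<ge>N. \<forall>j\<ge>N. (\<integral>x. (s i x - s j x) ^ 4 \<partial>M) \<le> \<epsilon> ^ 4"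
  shows "\<exists>Y. L2_tendsto M s Y"
proof -
  note [measurable] = L4_spaceD(1)[OF s]
  have d: "(\<lambda>x. s i x - s j x) \<in> L4_space M" for i j
    by (rule L4_space_diff[OF s s])
  have int: "integrable M (s n)" for n
    using integral_square_le_L2(1)[OF L4_space_subset_L2(1)[OF s]] .
  have "\<exists>N. \<forall>i\<ge>N. \<forall>j\<ge>N. (\<integral>x. norm (s i x - s j x) \<partial>M) < \<epsilon>" if "\<epsilon> > 0" for \<epsilon>
  proof -
    obtain N where "\<forall>i\<ge>N. \<forall>j\<ge>N. (\<integral>x. (s i x - s j x) ^ 4 \<partial>M) \<le> (\<epsilon>/2) ^ 4"
      using Cauchy[of "\<epsilon>/2"] \<open>\<epsilon> > 0\<close> by auto
    then have "\<forall>i\<ge>N. \<forall>j\<ge>N. (\<integral>x. norm (s i x - s j x) \<partial>M) \<le> \<epsilon>/2"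
      using abs_integral_le_fourth_moment(1)[OF d, of _ _ "\<epsilon>/2"] \<open>\<epsilon> > 0\<close> by auto
    then show ?thesis using \<open>\<epsilon> > 0\<close>
      by (intro exI[of _ N] allI impI) (smt (verit) field_sum_of_halves)
  qed
  then obtain r where r: "strict_mono r" "AE x in M. Cauchy (\<lambda>i. s (r i) x)"
    using cauchy_L1_AE_cauchy_subseq[of M s] int by blast
  \<comment> \<open>Where the subsequence diverges \<open>lim\<close> is an unspecified value; this
    concerns a null set only.\<close>
  define Y where "Y x = lim (\<lambda>i. s (r i) x)" for x
  have Y[measurable]: "Y \<in> borel_measurable M" unfolding Y_def by measurable
  have limY: "AE x in M. (\<lambda>i. s (r i) x) \<longlonglongrightarrow> Y x"
    using r(2) by eventually_elim (auto simp: Y_def Cauchy_convergent_iff convergent_LIMSEQ_iff)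
  have diff: "(\<lambda>x. s n x - Y x) \<in> L4_space M \<and> (\<integral>x. (s n x - Y x) ^ 4 \<partial>M) \<le> c ^ 4"
    if c: "\<forall>i\<ge>N. \<forall>j\<ge>N. (\<integral>x. (s i x - s j x) ^ 4 \<partial>M) \<le> c ^ 4" and n: "n \<ge> N" for n N c
  proof -
    have "r i \<ge> i" for i using r(1) by (rule seq_suble)
    then have le: "(\<integral>x. (s n x - s (r i) x) ^ 4 \<partial>M) \<le> c ^ 4" if "i \<ge> N" for i
      using c n that by (meson order.trans)
    have lim: "AE x in M. (\<lambda>i. s n x - s (r i) x) \<longlonglongrightarrow> s n x - Y x"
      using limY by eventually_elim (intro tendsto_intros)
    show ?thesis
      using fourth_moment_Fatou[where f = "\<lambda>i x. s n x - s (r i) x", OF d _ lim le] by auto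
  qed
  \<comment> \<open>\<open>Y\<close> is \<open>s N\<close> minus the difference
    \<open>s N - Y\<close>, and both have finite fourth moment.\<close>
  have Y4: "Y \<in> L4_space M"
  proof -
    obtain N where N: "\<forall>i\<ge>N. \<forall>j\<ge>N. (\<integral>x. (s i x - s j x) ^ 4 \<partial>M) \<le> 1 ^ 4"
      using Cauchy[of 1] by auto
    show ?thesis using L4_space_diff[OF s[of N] diff[OF N order.refl, THEN conjunct1]] by simp
  qed
  have "(\<lambda>n. L2_norm M (\<lambda>x. s n x - Y x)) \<longlonglongrightarrow> 0"
  proof (rule LIMSEQ_I)
    fix \<epsilon> :: real assume e: "\<epsilon> > 0"
    obtain N where N: "\<forall>i\<ge>N. \<forall>j\<ge>N. (\<integral>x. (s i x - s j x) ^ 4 \<partial>M) \<le> (\<epsilon>/2) ^ 4"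
      using Cauchy[of "\<epsilon>/2"] e by auto
    have "norm (L2_norm M (\<lambda>x. s n x - Y x) - 0) < \<epsilon>" if "n \<ge> N" for n
    proof -
      have "(\<integral>x. (s n x - Y x)\<^sup>2 \<partial>M) \<le> (\<epsilon>/2)\<^sup>2"
        using diff[OF N that] abs_integral_le_fourth_moment(2) e by auto
      then have "L2_norm M (\<lambda>x. s n x - Y x) \<le> \<epsilon>/2"
        unfolding L2_norm_def L2_inner_self using e by (intro real_le_lsqrt) auto
      moreover have "0 \<le> L2_norm M (\<lambda>x. s n x - Y x)"
        unfolding L2_norm_def using L2_inner_self_nonneg by auto
      ultimately show ?thesis using e by auto
    qed
    then show "\<exists>N. \<forall>n\<ge>N. norm (L2_norm M (\<lambda>x. s n x - Y x) - 0) < \<epsilon>" by blast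
  qed
  then show ?thesis
    using L4_space_subset_L2(1)[OF s] L4_space_subset_L2(1)[OF Y4]
    unfolding L2_tendsto_def by blast
qed

text \<open>Blocks of a convergent series become small, and the hypothesis bounds the fourth moment
  of an increment by the square of such a block.\<close>

lemma (in prob_space) L2_limit_exists_of_summable:
  fixes s :: "nat \<Rightarrow> 'a \<Rightarrow> real"
  assumes s: "\<And>n. s n \<in> L4_space M" and D: "D \<ge> 0" and \<alpha>: "summable \<alpha>" "\<And>j. 0 \<le> \<alpha> j"
    and le: "\<And>m n. m \<le> n \<Longrightarrow> (\<integral>x. (s n x - s m x) ^ 4 \<partial>M) \<le> D * (\<Sum>j\<in>{m<..n}. \<alpha> j)\<^sup>2"
  shows "\<exists>Y. L2_tendsto M s Y"
proof (rule L2_limit_exists[OF s])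
  fix \<epsilon> :: real assume e: "\<epsilon> > 0"
  \<comment> \<open>Solves (D + 1) \<delta>^2 = \<epsilon>^4; the added 1 covers the case
    \<open>D = 0\<close>.\<close>
  define \<delta> where "\<delta> = \<epsilon>\<^sup>2 / sqrt (D + 1)"
  have \<delta>: "\<delta> > 0" using e D by (simp add: \<delta>_def)
  obtain N where N: "\<And>m n. m \<ge> N \<Longrightarrow> norm (sum \<alpha> {m..<n}) < \<delta>"
    using \<alpha>(1) \<delta> unfolding summable_Cauchy by blast
  have 1: "(\<integral>x. (s n x - s m x) ^ 4 \<partial>M) \<le> \<epsilon> ^ 4" if "N \<le> m" "m \<le> n" for m n
  proof -
    have "{m<..n} = {Suc m..<Suc n}" by auto
    then have "\<bar>\<Sum>j\<in>{m<..n}. \<alpha> j\<bar> \<le> \<delta>" using N[of "Suc m" "Suc n"] that by simp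
    then have "(\<Sum>j\<in>{m<..n}. \<alpha> j)\<^sup>2 \<le> \<delta>\<^sup>2" using \<delta> by (simp add: abs_le_square_iff[symmetric])
    then have "D * (\<Sum>j\<in>{m<..n}. \<alpha> j)\<^sup>2 \<le> (D + 1) * \<delta>\<^sup>2"
      using D by (intro mult_mono) auto
    also have "\<dots> = \<epsilon> ^ 4"
      using D by (simp add: \<delta>_def power_divide flip: power_mult)
    finally show ?thesis using le[OF that(2)] by linarith
  qed
  have "(\<integral>x. (s i x - s j x) ^ 4 \<partial>M) \<le> \<epsilon> ^ 4" if "N \<le> i" "N \<le> j" for i j
  proof (cases "i \<le> j")
    case True
    then show ?thesis using 1[of i j] that by (simp add: power4_eq_xxxx algebra_simps)
  qed (use 1[of j i] that in simp)
  then show "\<exists>N. \<forall>i\<ge>N. \<forall>j\<ge>N. (\<integral>x. (s i x - s j x) ^ 4 \<partial>M) \<le> \<epsilon> ^ 4" by blast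
qed

text \<open>Carries a bound that is uniform over partial sums to arbitrary versions of the two L^2
  limits, in particular to those picked by \<open>SOME\<close>. The bound concerns the difference of
  the sums, so Fatou's lemma needs one subsequence along which both sums converge almost
  everywhere.\<close>

lemma (in prob_space) fourth_moment_L2_limit_diff:
  assumes s: "L2_tendsto M s Y" and s': "L2_tendsto M s' Y'"
    and d: "\<And>n. (\<lambda>x. s n x - s' n x) \<in> L4_space M"
    and le: "\<And>n. (\<integral>x. (s n x - s' n x) ^ 4 \<partial>M) \<le> c"
  shows "(\<lambda>x. Y x - Y' x) \<in> L4_space M" "(\<integral>x. (Y x - Y' x) ^ 4 \<partial>M) \<le> c"
proof -
  have L2: "s n \<in> L2_space M" "s' n \<in> L2_space M" "Y \<in> L2_space M" "Y' \<in> L2_space M" for n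
    using s s' by (auto simp: L2_tendsto_def)
  \<comment> \<open>The parameter \<open>q\<close> permits the second extraction to run inside the
    subsequence chosen for the first limit.\<close>
  have sub: "\<exists>r::nat \<Rightarrow> nat. strict_mono r \<and> (AE x in M. (\<lambda>n. t (q (r n)) x - T x) \<longlonglongrightarrow> 0)"
    if t: "L2_tendsto M t T" and q: "strict_mono q" for t T and q :: "nat \<Rightarrow> nat"
  proof (rule tendsto_L1_AE_subseq)
    have T: "(\<lambda>x. t n x - T x) \<in> L2_space M" for n
      using t by (intro L2_space_diff) (auto simp: L2_tendsto_def)
    then show "integrable M (\<lambda>x. t (q n) x - T x)" for n by (rule integral_square_le_L2)
    have A: "(\<lambda>n. L2_norm M (\<lambda>x. t (q n) x - T x)) \<longlonglongrightarrow> 0"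
      using t LIMSEQ_subseq_LIMSEQ[OF _ q, of "\<lambda>n. L2_norm M (\<lambda>x. t n x - T x)" 0]
      by (auto simp: L2_tendsto_def comp_def)
    have B: "(\<integral>x. norm (t n x - T x) \<partial>M) \<le> L2_norm M (\<lambda>x. t n x - T x)" for n
    proof -
      have "(\<lambda>x. \<bar>t n x - T x\<bar>) \<in> L2_space M"
        using L2_spaceD[OF T[of n]] borel_measurable_abs[OF L2_spaceD(1)[OF T[of n]]]
        by (simp add: L2_space_def)
      from integral_square_le_L2(2)[OF this] show ?thesis
        unfolding L2_norm_def L2_inner_self by (intro real_le_rsqrt) simp
    qed
    show "(\<lambda>n. \<integral>x. norm (t (q n) x - T x) \<partial>M) \<longlonglongrightarrow> 0"
      by (rule real_tendsto_sandwich[OF _ _ tendsto_const A]) (simp, intro always_eventually allI B)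
  qed
  obtain r1 where r1: "strict_mono r1" "AE x in M. (\<lambda>n. s (r1 n) x - Y x) \<longlonglongrightarrow> 0"
    using sub[OF s strict_mono_id] by (auto simp: id_def)
  obtain r2 where r2: "strict_mono r2" "AE x in M. (\<lambda>n. s' (r1 (r2 n)) x - Y' x) \<longlonglongrightarrow> 0"
    using sub[OF s' r1(1)] by auto
  have lim: "AE x in M. (\<lambda>n. s (r1 (r2 n)) x - s' (r1 (r2 n)) x) \<longlonglongrightarrow> Y x - Y' x"
    using r1(2) r2(2)
  proof eventually_elim
    case (elim x)
    have "(\<lambda>n. s (r1 (r2 n)) x - Y x) \<longlonglongrightarrow> 0"
      using LIMSEQ_subseq_LIMSEQ[OF elim(1) r2(1)] by (simp add: comp_def)
    then show ?case using elim(2) by (intro tendsto_diff) (auto simp: LIM_zero_iff)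
  qed
  have "(\<lambda>x. Y x - Y' x) \<in> borel_measurable M"
    using L2(3,4) by (auto simp: L2_space_def)
  from fourth_moment_Fatou[where f="\<lambda>n x. s (r1 (r2 n)) x - s' (r1 (r2 n)) x", OF d this lim le]
  show "(\<lambda>x. Y x - Y' x) \<in> L4_space M" "(\<integral>x. (Y x - Y' x) ^ 4 \<partial>M) \<le> c" by auto
qed

section \<open>Dyadic chaining and time change\<close>

definition dyadic_floor :: "nat \<Rightarrow> real \<Rightarrow> real" where
  "dyadic_floor n u = real (nat \<lfloor>2 ^ n * u\<rfloor>) / 2 ^ n"

lemma dyadic_floor_bounds:
  assumes "0 \<le> u"
  shows "0 \<le> dyadic_floor n u" "dyadic_floor n u \<le> u" "u - dyadic_floor n u \<le> (1/2) ^ n"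
proof -
  have k: "real (nat \<lfloor>2 ^ n * u\<rfloor>) = of_int \<lfloor>2 ^ n * u\<rfloor>" using assms by simp
  show "0 \<le> dyadic_floor n u" by (simp add: dyadic_floor_def)
  show "dyadic_floor n u \<le> u"
    unfolding dyadic_floor_def k by (simp add: divide_le_eq mult.commute)
  have "2 ^ n * u \<le> of_int \<lfloor>2 ^ n * u\<rfloor> + 1" by linarith
  then have "u \<le> (of_int \<lfloor>2 ^ n * u\<rfloor> + 1) / 2 ^ n"
    by (simp add: pos_le_divide_eq mult.commute)
  then show "u - dyadic_floor n u \<le> (1/2) ^ n"
    unfolding dyadic_floor_def k by (simp add: add_divide_distrib power_one_over)
qed

text \<open>The deterministic half of chaining. Passing from level n to level n + 1, the dyadic
  floor either stays or moves right by one cell of level n + 1, so the values of \<open>w\<close>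
  along the floors have geometrically small steps. No regularity of \<open>w\<close> beyond its
  increments on the dyadic grids enters, and off the dyadic points the limit may differ from
  \<open>w\<close>.\<close>

lemma dyadic_floor_limit:
  fixes w :: "real \<Rightarrow> real"
  assumes q: "0 < q" "q < 1"
    and inc: "\<And>n i. i < 2 ^ n \<Longrightarrow> \<bar>w (real (Suc i) / 2 ^ n) - w (real i / 2 ^ n)\<bar> \<le> R * q ^ n"
  shows "u \<in> {0..1} \<Longrightarrow> (\<lambda>n. w (dyadic_floor n u)) \<longlonglongrightarrow> lim (\<lambda>n. w (dyadic_floor n u))"
    and "continuous_on {0..1} (\<lambda>u. lim (\<lambda>n. w (dyadic_floor n u)))"
proof -
  have R: "0 \<le> R" using inc[of 0 0] by simp
  have fl: "nat \<lfloor>2 ^ n * u\<rfloor> \<le> 2 ^ n" if "u \<le> 1" for n and u :: real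
  proof -
    have "2 ^ n * u \<le> 2 ^ n" using that by simp
    then have "\<lfloor>2 ^ n * u\<rfloor> \<le> \<lfloor>2 ^ n :: real\<rfloor>" by (rule floor_mono)
    also have "\<lfloor>2 ^ n :: real\<rfloor> = 2 ^ n"
      using floor_of_int[of "2 ^ n :: int", where 'a=real] by simp
    finally show ?thesis by (simp add: nat_le_iff)
  qed
  have st: "\<bar>w (dyadic_floor (Suc n) u) - w (dyadic_floor n u)\<bar> \<le> R * q ^ Suc n"
    if u: "0 \<le> u" "u \<le> 1" for n u
  proof -
    define k where "k = nat \<lfloor>2 ^ n * u\<rfloor>"
    have k: "real k \<le> 2 ^ n * u" "2 ^ n * u < real k + 1"
      unfolding k_def using u(1) by (auto simp: of_nat_nat)
    have "2 * int k \<le> \<lfloor>2 ^ Suc n * u\<rfloor>" "\<lfloor>2 ^ Suc n * u\<rfloor> < 2 * int k + 2"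
      using k by (simp_all add: le_floor_iff floor_less_iff)
    then consider "nat \<lfloor>2 ^ Suc n * u\<rfloor> = 2 * k" | "nat \<lfloor>2 ^ Suc n * u\<rfloor> = Suc (2 * k)"
      by linarith
    then show ?thesis
    proof cases
      case 1
      then have "dyadic_floor (Suc n) u = dyadic_floor n u"
        unfolding dyadic_floor_def 1 k_def[symmetric] by simp
      then show ?thesis using R q by simp
    next
      case 2
      \<comment> \<open>The increment in question has left index \<open>2 * k\<close>, and
        \<open>inc\<close> asks for an index strictly below the number of cells.\<close>
      have "Suc (2 * k) \<le> 2 ^ Suc n" using fl[of u "Suc n"] u 2 by simp
      then have "2 * k < 2 ^ Suc n" by simp
      from inc[OF this] show ?thesis
        unfolding dyadic_floor_def 2 k_def[symmetric] by simp
    qed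
  qed
  \<comment> \<open>The sum of the allowed steps \<open>R * q ^ k\<close> over all k > n.\<close>
  define T where "T n = R * q ^ Suc n / (1 - q)" for n
  have tail: "\<bar>w (dyadic_floor m u) - w (dyadic_floor n u)\<bar> \<le> T n"
    if u: "0 \<le> u" "u \<le> 1" and "n \<le> m" for m n u
  proof -
    \<comment> \<open>The sharper bound \<open>T n - T m\<close> is what the induction can carry: it
      grows by exactly one allowed step.\<close>
    have "\<bar>w (dyadic_floor m u) - w (dyadic_floor n u)\<bar> \<le> T n - T m"
      using \<open>n \<le> m\<close>
    proof (induction m rule: dec_induct)
      case (step m)
      have "T m - T (Suc m) = R * q ^ Suc m"
      proof -
        have "T m - T (Suc m) = (R * q ^ Suc m) * (1 - q) / (1 - q)"
          unfolding T_def by (simp add: algebra_simps flip: diff_divide_distrib)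
        then show ?thesis using q by simp
      qed
      then show ?case using step.IH
        st[OF u, of m] by linarith
    qed simp
    moreover have "0 \<le> T m" unfolding T_def using R q by simp
    ultimately show ?thesis by linarith
  qed
  have q0: "(\<lambda>n. q ^ n) \<longlonglongrightarrow> 0" by (rule LIMSEQ_power_zero) (use q in simp)
  from q0 have "(\<lambda>n. (R * q / (1 - q)) * q ^ n) \<longlonglongrightarrow> (R * q / (1 - q)) * 0" by (rule tendsto_mult_left)
  then have T0: "T \<longlonglongrightarrow> 0" unfolding T_def by (simp add: mult.assoc)
  have conv: "(\<lambda>n. w (dyadic_floor n u)) \<longlonglongrightarrow> lim (\<lambda>n. w (dyadic_floor n u))" if "u \<in> {0..1}" for u
  proof -
    have u: "0 \<le> u" "u \<le> 1" using that by auto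
    have "Cauchy (\<lambda>n. w (dyadic_floor n u))"
    proof (rule CauchyI')
      fix e :: real assume "0 < e"
      then obtain N where N: "\<And>n. n \<ge> N \<Longrightarrow> norm (T n - 0) < e" using LIMSEQ_D[OF T0] by blast
      have "dist (w (dyadic_floor m u)) (w (dyadic_floor n u)) < e" if "m \<ge> N" "n > m" for m n
        using tail[OF u, of m n] N[of m] that by (simp add: dist_real_def abs_minus_commute)
      then show "\<exists>N. \<forall>m\<ge>N. \<forall>n>m. dist (w (dyadic_floor m u)) (w (dyadic_floor n u)) < e" by blast
    qed
    then show ?thesis by (simp add: Cauchy_convergent_iff convergent_LIMSEQ_iff)
  qed
  show "u \<in> {0..1} \<Longrightarrow> (\<lambda>n. w (dyadic_floor n u)) \<longlonglongrightarrow> lim (\<lambda>n. w (dyadic_floor n u))"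
    by (rule conv)
  define L where "L u = lim (\<lambda>n. w (dyadic_floor n u))" for u
  have Ltail: "\<bar>L u - w (dyadic_floor n u)\<bar> \<le> T n" if "u \<in> {0..1}" for u n
  proof (rule LIMSEQ_le_const2)
    show "(\<lambda>m. \<bar>w (dyadic_floor m u) - w (dyadic_floor n u)\<bar>) \<longlonglongrightarrow> \<bar>L u - w (dyadic_floor n u)\<bar>"
      unfolding L_def using conv[OF that] by (intro tendsto_intros)
    show "\<exists>N. \<forall>m\<ge>N. \<bar>w (dyadic_floor m u) - w (dyadic_floor n u)\<bar> \<le> T n"
      using tail that by auto
  qed
  \<comment> \<open>Points at distance less than one cell have equal or adjacent dyadic
    floors.\<close>
  have near: "\<bar>w (dyadic_floor n v) - w (dyadic_floor n u)\<bar> \<le> R * q ^ n"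
    if uv: "0 \<le> u" "u \<le> v" "v \<le> 1" "v - u < (1/2) ^ n" for u v n
  proof -
    define k where "k = nat \<lfloor>2 ^ n * u\<rfloor>"
    have k: "real k \<le> 2 ^ n * u" "2 ^ n * u < real k + 1"
      unfolding k_def using uv(1) by (auto simp: of_nat_nat)
    have "2 ^ n * (v - u) < 2 ^ n * (1/2) ^ n" using uv(4) by (intro mult_strict_left_mono) auto
    then have "2 ^ n * v < 2 ^ n * u + 1" by (simp add: algebra_simps power_one_over)
    moreover have "2 ^ n * u \<le> 2 ^ n * v" using uv(2) by simp
    ultimately have "real k \<le> 2 ^ n * v" "2 ^ n * v < real k + 2" using k by linarith+
    then have "int k \<le> \<lfloor>2 ^ n * v\<rfloor>" "\<lfloor>2 ^ n * v\<rfloor> < int k + 2"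
      by (simp_all add: le_floor_iff floor_less_iff)
    then consider "nat \<lfloor>2 ^ n * v\<rfloor> = k" | "nat \<lfloor>2 ^ n * v\<rfloor> = Suc k" by linarith
    then show ?thesis
    proof cases
      case 1
      then show ?thesis unfolding dyadic_floor_def 1 k_def[symmetric] using R q by simp
    next
      case 2
      have "k < 2 ^ n" using fl[OF uv(3), of n] 2 by simp
      from inc[OF this] show ?thesis unfolding dyadic_floor_def 2 k_def[symmetric] .
    qed
  qed
  have osc: "\<bar>L v - L u\<bar> \<le> 2 * T n + R * q ^ n"
    if "u \<in> {0..1}" "v \<in> {0..1}" "\<bar>v - u\<bar> < (1/2) ^ n" for u v n
  proof -
    have "\<bar>w (dyadic_floor n v) - w (dyadic_floor n u)\<bar> \<le> R * q ^ n"
      using near[of u v n] near[of v u n] that by (cases "u \<le> v") auto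
    then show ?thesis using Ltail[OF that(1), of n] Ltail[OF that(2), of n] by linarith
  qed
  have C0: "(\<lambda>n. 2 * T n + R * q ^ n) \<longlonglongrightarrow> 2 * 0 + R * 0"
    using T0 q0 by (intro tendsto_add tendsto_mult_left)
  show "continuous_on {0..1} (\<lambda>u. lim (\<lambda>n. w (dyadic_floor n u)))"
    unfolding L_def[symmetric] continuous_on_iff
  proof (intro ballI allI impI)
    fix u e :: real assume u: "u \<in> {0..1}" and "0 < e"
    then obtain n where n: "norm ((2 * T n + R * q ^ n) - 0) < e" using LIMSEQ_D[OF C0, of e] by auto
    have "dist (L v) (L u) < e" if "v \<in> {0..1}" "dist v u < (1/2) ^ n" for v
      using osc[OF u that(1), of n] that(2) n by (simp add: dist_real_def)
    then show "\<exists>d>0. \<forall>v\<in>{0..1}. dist v u < d \<longrightarrow> dist (L v) (L u) < e"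
      by (intro exI[of _ "(1/2) ^ n"]) auto
  qed
qed

lemma LIMSEQ_pow4_zeroD:
  fixes f :: "nat \<Rightarrow> real"
  assumes "(\<lambda>n. f n ^ 4) \<longlonglongrightarrow> 0"
  shows "f \<longlonglongrightarrow> 0"
proof -
  have "(\<lambda>n. sqrt (sqrt (f n ^ 4))) \<longlonglongrightarrow> sqrt (sqrt 0)"
    using assms by (intro tendsto_real_sqrt)
  moreover have "sqrt (sqrt (f n ^ 4)) = \<bar>f n\<bar>" for n
  proof -
    have *: "f n ^ 4 = ((f n)\<^sup>2)\<^sup>2" by (simp flip: power_mult)
    show ?thesis unfolding * real_sqrt_abs by simp
  qed
  ultimately show ?thesis by (simp add: tendsto_rabs_zero_iff)
qed

text \<open>The moment bound is used twice. Summed over the grids it controls all neighbouring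
  dyadic increments of almost every path, which is what \<open>dyadic_floor_limit\<close> asks for.
  At a fixed \<open>u\<close> it shows that the limit along the dyadic floors is a version of
  \<open>W u\<close>.\<close>

lemma (in prob_space) Kolmogorov_continuous_modification:
  fixes W :: "real \<Rightarrow> 'a \<Rightarrow> real"
  assumes W: "\<And>u. u \<in> {0..1} \<Longrightarrow> W u \<in> borel_measurable M"
    and W4: "\<And>u v. u \<in> {0..1} \<Longrightarrow> v \<in> {0..1} \<Longrightarrow> (\<lambda>\<omega>. W u \<omega> - W v \<omega>) \<in> L4_space M"
    and le: "\<And>u v. u \<in> {0..1} \<Longrightarrow> v \<in> {0..1} \<Longrightarrow> (\<integral>\<omega>. (W u \<omega> - W v \<omega>) ^ 4 \<partial>M) \<le> C * (u - v)\<^sup>2"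
  shows "\<exists>W' :: real \<Rightarrow> 'a \<Rightarrow> real.
    (\<forall>u\<in>{0..1}. W' u \<in> borel_measurable M) \<and>
    (\<forall>\<omega>\<in>space M. continuous_on {0..1} (\<lambda>u. W' u \<omega>)) \<and>
    (\<forall>u\<in>{0..1}. AE \<omega> in M. W' u \<omega> = W u \<omega>)"
proof -
  \<comment> \<open>Any \<open>q < 1\<close> with \<open>2 * q ^ 4 > 1\<close> will do: there are \<open>2 ^ n\<close> increments of fourth moment
    \<open>C / 4 ^ n\<close> on level \<open>n\<close>.\<close>
  define q :: real where "q = 9 / 10"
  have q: "0 < q" "q < 1" by (simp_all add: q_def)
  define \<Delta> where "\<Delta> n i \<omega> = W (real (Suc i) / 2 ^ n) \<omega> - W (real i / 2 ^ n) \<omega>" for n i \<omega>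
  have grid: "real i / 2 ^ n \<in> {0..1}" "real (Suc i) / 2 ^ n \<in> {0..1}" if "i < 2 ^ n" for i n
  proof -
    have "Suc i \<le> 2 ^ n" using that by simp
    then have "real (Suc i) \<le> real (2 ^ n)" by (simp only: of_nat_le_iff)
    then show "real i / 2 ^ n \<in> {0..1}" "real (Suc i) / 2 ^ n \<in> {0..1}"
      using that by auto
  qed
  have \<Delta>: "integrable M (\<lambda>\<omega>. \<Delta> n i \<omega> ^ 4)" "(\<integral>\<omega>. \<Delta> n i \<omega> ^ 4 \<partial>M) \<le> C * (1/4) ^ n" if "i < 2 ^ n" for n i
  proof -
    show "integrable M (\<lambda>\<omega>. \<Delta> n i \<omega> ^ 4)"
      unfolding \<Delta>_def by (rule L4_spaceD(2)[OF W4[OF grid(2,1)[OF that]]])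
    have "real (Suc i) / 2 ^ n - real i / 2 ^ n = (1/2) ^ n" by (simp add: field_simps)
    moreover have "((1/2) ^ n)\<^sup>2 = (1/4::real) ^ n" by (simp add: power2_eq_square flip: power_mult_distrib)
    ultimately show "(\<integral>\<omega>. \<Delta> n i \<omega> ^ 4 \<partial>M) \<le> C * (1/4) ^ n"
      using le[OF grid(2,1)[OF that]] unfolding \<Delta>_def by simp
  qed
  \<comment> \<open>The expectation of \<open>A n\<close> is at most C (1 / (2 q^4))^n, so almost
    surely these sums are summable in n; a bound on \<open>A n\<close> then bounds every increment
    of level n in units of \<open>q ^ n\<close>.\<close>
  define A where "A n \<omega> = (\<Sum>i<2^n. \<Delta> n i \<omega> ^ 4) / (q ^ n) ^ 4" for n \<omega>
  have "AE \<omega> in M. summable (\<lambda>n. A n \<omega>)"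
  proof (rule AE_summable_of_summable_integral)
    show "integrable M (A n)" for n
      unfolding A_def using \<Delta>(1) by (intro integrable_divide_zero Bochner_Integration.integrable_sum) auto
    show "0 \<le> A n \<omega>" for n \<omega> unfolding A_def using q by (auto intro!: divide_nonneg_pos sum_nonneg)
    show "(\<integral>\<omega>. A n \<omega> \<partial>M) \<le> C * (1 / (2 * q ^ 4)) ^ n" for n
    proof -
      have "(\<integral>\<omega>. A n \<omega> \<partial>M) = (\<Sum>i<2^n. \<integral>\<omega>. \<Delta> n i \<omega> ^ 4 \<partial>M) / (q ^ n) ^ 4"
        unfolding A_def using \<Delta>(1) by (simp add: Bochner_Integration.integral_sum)
      also have "\<dots> \<le> (\<Sum>i<(2::nat)^n. C * (1/4) ^ n) / (q ^ n) ^ 4"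
        using q by (intro divide_right_mono sum_mono \<Delta>(2)) auto
      also have "\<dots> = C * (2 ^ n * (1/4) ^ n / (q ^ 4) ^ n)"
        by (simp add: mult.commute flip: power_mult)
      also have "2 ^ n * (1/4) ^ n / (q ^ 4) ^ n = (2 * (1/4) / q ^ 4) ^ n"
        by (simp only: power_divide power_mult_distrib)
      also have "2 * (1/4) / q ^ 4 = 1 / (2 * q ^ 4)" by simp
      finally show ?thesis .
    qed
    show "summable (\<lambda>n. C * (1 / (2 * q ^ 4)) ^ n)"
      by (intro summable_mult summable_geometric) (simp add: q_def power4_eq_xxxx)
  qed
  then have "AE \<omega> in M. \<exists>R. \<forall>n i. i < 2 ^ n \<longrightarrow> \<bar>\<Delta> n i \<omega>\<bar> \<le> R * q ^ n"
  proof eventually_elim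
    case (elim \<omega>)
    \<comment> \<open>The lower bound 1 gives R <= R^4, so that fourth powers can be compared
      without introducing a fourth root.\<close>
    define R where "R = max 1 (\<Sum>n. A n \<omega>)"
    have A0: "0 \<le> A n \<omega>" for n unfolding A_def using q by (auto intro!: divide_nonneg_pos sum_nonneg)
    have "\<bar>\<Delta> n i \<omega>\<bar> \<le> R * q ^ n" if i: "i < 2 ^ n" for n i
    proof -
      have "\<Delta> n i \<omega> ^ 4 \<le> (\<Sum>i<2^n. \<Delta> n i \<omega> ^ 4)"
        using i by (intro member_le_sum) auto
      also have "\<dots> = A n \<omega> * (q ^ n) ^ 4" unfolding A_def using q by simp
      also have "A n \<omega> \<le> R"
        using sum_le_suminf[OF elim, of "{n}"] A0 unfolding R_def by auto
      also have "R \<le> R ^ 4" using self_le_power[of R 4] unfolding R_def by simp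
      finally have "\<bar>\<Delta> n i \<omega>\<bar> ^ 4 \<le> (R * q ^ n) ^ 4"
        using q by (simp add: power_mult_distrib mult_right_mono)
      then show ?thesis by (rule power_mono_iff[THEN iffD1, rotated -1]) (use q in \<open>auto simp: R_def\<close>)
    qed
    then show ?case by blast
  qed
  then obtain N where N: "{\<omega> \<in> space M. \<not> (\<exists>R. \<forall>n i. i < 2 ^ n \<longrightarrow> \<bar>\<Delta> n i \<omega>\<bar> \<le> R * q ^ n)} \<subseteq> N"
      "emeasure M N = 0" "N \<in> sets M"
    by (rule AE_E)
  \<comment> \<open>The value 0 on the null set \<open>N\<close> makes every path continuous, not
    only almost every one.\<close>
  define W' where "W' u \<omega> = (if \<omega> \<in> N then 0 else lim (\<lambda>n. W (dyadic_floor n u) \<omega>))" for u \<omega>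
  have df: "dyadic_floor n u \<in> {0..1}" if "u \<in> {0..1}" for n u
    using dyadic_floor_bounds[of u n] that by auto
  have good: "u \<in> {0..1} \<Longrightarrow> (\<lambda>n. W (dyadic_floor n u) \<omega>) \<longlonglongrightarrow> W' u \<omega>"
    "continuous_on {0..1} (\<lambda>u. W' u \<omega>)" if \<omega>: "\<omega> \<in> space M" "\<omega> \<notin> N" for \<omega> u
  proof -
    obtain R where R: "\<And>n i. i < 2 ^ n \<Longrightarrow> \<bar>\<Delta> n i \<omega>\<bar> \<le> R * q ^ n" using N(1) \<omega> by blast
    show "u \<in> {0..1} \<Longrightarrow> (\<lambda>n. W (dyadic_floor n u) \<omega>) \<longlonglongrightarrow> W' u \<omega>"
      "continuous_on {0..1} (\<lambda>u. W' u \<omega>)"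
      using dyadic_floor_limit[OF q, of "\<lambda>u. W u \<omega>" R] R \<omega>(2) unfolding W'_def \<Delta>_def by simp_all
  qed
  have "W' u \<in> borel_measurable M" if "u \<in> {0..1}" for u
    unfolding W'_def using W[OF df[OF that]] N(3) by measurable
  moreover have "continuous_on {0..1} (\<lambda>u. W' u \<omega>)" if "\<omega> \<in> space M" for \<omega>
    by (cases "\<omega> \<in> N") (use good(2) that in \<open>auto simp: W'_def\<close>)
  moreover have "AE \<omega> in M. W' u \<omega> = W u \<omega>" if u: "u \<in> {0..1}" for u
  proof -
    \<comment> \<open>The sign of \<open>C\<close> is forced by the moment bound between the end
      points.\<close>
    have C: "0 \<le> C"
    proof -
      have "0 \<le> (\<integral>\<omega>. (W 1 \<omega> - W 0 \<omega>) ^ 4 \<partial>M)" by simp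
      also have "\<dots> \<le> C" using le[of 1 0] by simp
      finally show ?thesis .
    qed
    \<comment> \<open>The fourth moments of the approximation errors decay like 4^(-n), so almost
      surely the errors tend to 0 along the full sequence.\<close>
    have "AE \<omega> in M. summable (\<lambda>n. (W (dyadic_floor n u) \<omega> - W u \<omega>) ^ 4)"
    proof (rule AE_summable_of_summable_integral)
      show "integrable M (\<lambda>\<omega>. (W (dyadic_floor n u) \<omega> - W u \<omega>) ^ 4)" for n
        by (rule L4_spaceD(2)[OF W4[OF df[OF u] u]])
      show "(\<integral>\<omega>. (W (dyadic_floor n u) \<omega> - W u \<omega>) ^ 4 \<partial>M) \<le> C * (1/4) ^ n" for n
      proof -
        have "(dyadic_floor n u - u)\<^sup>2 \<le> ((1/2) ^ n)\<^sup>2"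
          using dyadic_floor_bounds[of u n] u by (simp add: abs_le_square_iff[symmetric] abs_if)
        also have "\<dots> = (1/4::real) ^ n" by (simp add: power2_eq_square flip: power_mult_distrib)
        finally show ?thesis
          using le[OF df[OF u] u, of n] mult_left_mono[OF _ C] by (meson order.trans)
      qed
      show "summable (\<lambda>n. C * (1/4::real) ^ n)" by (intro summable_mult summable_geometric) simp
    qed simp
    moreover have "AE \<omega> in M. \<omega> \<notin> N" using N(2,3) by (intro AE_not_in) auto
    ultimately show ?thesis using AE_space
    proof eventually_elim
      case (elim \<omega>)
      have "(\<lambda>n. W (dyadic_floor n u) \<omega> - W u \<omega>) \<longlonglongrightarrow> 0"
        using summable_LIMSEQ_zero[OF elim(1)] by (rule LIMSEQ_pow4_zeroD)
      then have "(\<lambda>n. W (dyadic_floor n u) \<omega>) \<longlonglongrightarrow> W u \<omega>" by (simp add: LIM_zero_iff)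
      with good(1)[OF elim(3,2) u] show ?case by (rule LIMSEQ_unique)
    qed
  qed
  ultimately show ?thesis by blast
qed

text \<open>Kolmogorov's criterion is applied to \<open>Z\<close> run by the inverse
  \<open>r\<close> of the clock \<gamma>, where the moment bound is quadratic in the length of the
  time interval. Composing the result with \<gamma> returns to the original time; for this
  continuity of \<gamma> is enough, that of \<open>r\<close> is never discussed.\<close>

lemma (in prob_space) continuous_modification_time_change:
  fixes Z :: "real \<Rightarrow> 'a \<Rightarrow> real" and g :: "real \<Rightarrow> real"
  assumes Z: "\<And>t. t \<in> {0..1} \<Longrightarrow> Z t \<in> borel_measurable M"
    and Z4: "\<And>s t. s \<in> {0..1} \<Longrightarrow> t \<in> {0..1} \<Longrightarrow> (\<lambda>\<omega>. Z s \<omega> - Z t \<omega>) \<in> L4_space M"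
    and le: "\<And>s t. s \<in> {0..1} \<Longrightarrow> t \<in> {0..1} \<Longrightarrow> (\<integral>\<omega>. (Z s \<omega> - Z t \<omega>) ^ 4 \<partial>M) \<le> C * (g s - g t)\<^sup>2"
    and g: "mono_on {0..1} g" "continuous_on {0..1} g" and C: "C \<ge> 0"
  shows "\<exists>Z' :: real \<Rightarrow> 'a \<Rightarrow> real.
    (\<forall>t\<in>{0..1}. Z' t \<in> borel_measurable M) \<and>
    (\<forall>\<omega>\<in>space M. continuous_on {0..1} (\<lambda>t. Z' t \<omega>)) \<and>
    (\<forall>t\<in>{0..1}. AE \<omega> in M. Z' t \<omega> = Z t \<omega>)"
proof -
  \<comment> \<open>The total increase of \<open>g t - g 0 + t\<close> on the unit interval, which
    normalises \<gamma> to end at 1.\<close>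
  define c where "c = g 1 - g 0 + 1"
  have c: "c > 0" using mono_onD[OF g(1), of 0 1] by (simp add: c_def)
  \<comment> \<open>The summand \<open>t\<close> makes \<open>\<gamma>\<close> a homeomorphism of the unit interval even where \<open>g\<close> is constant.\<close>
  define \<gamma> where "\<gamma> t = (g t - g 0 + t) / c" for t
  have \<gamma>01: "\<gamma> 0 = 0" "\<gamma> 1 = 1" using c by (simp_all add: \<gamma>_def c_def)
  have cont: "continuous_on {0..1} \<gamma>" unfolding \<gamma>_def using c by (intro continuous_intros g(2)) auto
  have g_le: "0 \<le> g t - g s \<and> g t - g s \<le> c * (\<gamma> t - \<gamma> s) - (t - s)"
    if "s \<in> {0..1}" "t \<in> {0..1}" "s \<le> t" for s t
    using mono_onD[OF g(1) that] c by (simp add: \<gamma>_def field_simps)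
  have less: "\<gamma> s < \<gamma> t" if "s \<in> {0..1}" "t \<in> {0..1}" "s < t" for s t
  proof -
    have "0 < c * (\<gamma> t - \<gamma> s)" using g_le[of s t] that by linarith
    then show ?thesis using c by (simp add: zero_less_mult_iff)
  qed
  have \<gamma>_range: "\<gamma> t \<in> {0..1}" if "t \<in> {0..1}" for t
    using less[of 0 t] less[of t 1] \<gamma>01 that by (cases "t = 0"; cases "t = 1"; force)
  have inj: "s = t" if "s \<in> {0..1}" "t \<in> {0..1}" "\<gamma> s = \<gamma> t" for s t
    using less[of s t] less[of t s] that by (cases s t rule: linorder_cases) auto
  define r where "r u = (SOME t. t \<in> {0..1} \<and> \<gamma> t = u)" for u
  have r: "r u \<in> {0..1} \<and> \<gamma> (r u) = u" if "u \<in> {0..1}" for u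
    unfolding r_def
  proof (rule someI_ex)
    show "\<exists>t. t \<in> {0..1} \<and> \<gamma> t = u"
      using IVT'[of \<gamma> 0 u 1] cont \<gamma>01 that by auto
  qed
  have r\<gamma>: "r (\<gamma> t) = t" if "t \<in> {0..1}" for t
    using r[OF \<gamma>_range[OF that]] that inj by blast
  \<comment> \<open>In the new clock \<open>g\<close> is Lipschitz with constant
    \<open>c\<close>.\<close>
  have sq: "(g (r u) - g (r v))\<^sup>2 \<le> c\<^sup>2 * (u - v)\<^sup>2" if "u \<in> {0..1}" "v \<in> {0..1}" for u v
  proof -
    have "\<bar>g (r u) - g (r v)\<bar> \<le> \<bar>c * (u - v)\<bar>"
      using g_le[of "r u" "r v"] g_le[of "r v" "r u"] r[OF that(1)] r[OF that(2)]
      by (cases "r u \<le> r v") (auto simp: algebra_simps)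
    then show ?thesis by (simp add: abs_le_square_iff power_mult_distrib)
  qed
  have "\<exists>W' :: real \<Rightarrow> 'a \<Rightarrow> real.
    (\<forall>u\<in>{0..1}. W' u \<in> borel_measurable M) \<and>
    (\<forall>\<omega>\<in>space M. continuous_on {0..1} (\<lambda>u. W' u \<omega>)) \<and>
    (\<forall>u\<in>{0..1}. AE \<omega> in M. W' u \<omega> = Z (r u) \<omega>)"
  proof (rule Kolmogorov_continuous_modification[where C="C * c\<^sup>2"])
    fix u v :: real assume uv: "u \<in> {0..1}" "v \<in> {0..1}"
    show "(\<integral>\<omega>. (Z (r u) \<omega> - Z (r v) \<omega>) ^ 4 \<partial>M) \<le> C * c\<^sup>2 * (u - v)\<^sup>2"
      using le[of "r u" "r v"] r[OF uv(1)] r[OF uv(2)] mult_left_mono[OF sq[OF uv] C]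
      by (simp add: mult.assoc)
  qed (use r Z Z4 in auto)
  then obtain W' :: "real \<Rightarrow> 'a \<Rightarrow> real" where W':
    "\<And>u. u \<in> {0..1} \<Longrightarrow> W' u \<in> borel_measurable M"
    "\<And>\<omega>. \<omega> \<in> space M \<Longrightarrow> continuous_on {0..1} (\<lambda>u. W' u \<omega>)"
    "\<And>u. u \<in> {0..1} \<Longrightarrow> AE \<omega> in M. W' u \<omega> = Z (r u) \<omega>"
    by blast
  show ?thesis
  proof (intro exI[of _ "\<lambda>t. W' (\<gamma> t)"] conjI ballI)
    fix \<omega> assume "\<omega> \<in> space M"
    then show "continuous_on {0..1} (\<lambda>t. W' (\<gamma> t) \<omega>)"
      by (rule continuous_on_compose2[OF W'(2) cont]) (use \<gamma>_range in auto)
  next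
    fix t :: real assume t: "t \<in> {0..1}"
    show "W' (\<gamma> t) \<in> borel_measurable M" by (rule W'(1)[OF \<gamma>_range[OF t]])
    show "AE \<omega> in M. W' (\<gamma> t) \<omega> = Z t \<omega>" using W'(3)[OF \<gamma>_range[OF t]] r\<gamma>[OF t] by simp
  qed
qed

section \<open>Tensors and the chaos maps\<close>

lemma (in pair_sigma_finite) integral_tensor:
  fixes u v :: "_ \<Rightarrow> real"
  assumes u: "integrable M1 u" and v: "integrable M2 v"
  shows "integrable (M1 \<Otimes>\<^sub>M M2) (\<lambda>z. u (fst z) * v (snd z))"
    and "(\<integral>z. u (fst z) * v (snd z) \<partial>(M1 \<Otimes>\<^sub>M M2)) = (\<integral>x. u x \<partial>M1) * (\<integral>y. v y \<partial>M2)"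
proof -
  have [measurable]: "u \<in> borel_measurable M1" "v \<in> borel_measurable M2" using u v by auto
  show int: "integrable (M1 \<Otimes>\<^sub>M M2) (\<lambda>z. u (fst z) * v (snd z))"
  proof (rule Fubini_integrable)
    show "integrable M1 (\<lambda>x. \<integral>y. norm (u (fst (x, y)) * v (snd (x, y))) \<partial>M2)"
      using u by (simp add: abs_mult)
    show "AE x in M1. integrable M2 (\<lambda>y. u (fst (x, y)) * v (snd (x, y)))"
      using v by simp
  qed measurable
  show "(\<integral>z. u (fst z) * v (snd z) \<partial>(M1 \<Otimes>\<^sub>M M2)) = (\<integral>x. u x \<partial>M1) * (\<integral>y. v y \<partial>M2)"
    using integral_fst'[OF int] by simp
qed

lemma tensor_apply: "tensor h g z = h (fst z) * g (snd z)"
  by (simp add: tensor_def split_beta)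

lemma (in pair_sigma_finite) L2_inner_tensor:
  assumes "a \<in> L2_space M1" "c \<in> L2_space M1" "b \<in> L2_space M2" "d \<in> L2_space M2"
  shows "L2_inner (M1 \<Otimes>\<^sub>M M2) (tensor a b) (tensor c d) = L2_inner M1 a c * L2_inner M2 b d"
proof -
  have "tensor a b z * tensor c d z = (a (fst z) * c (fst z)) * (b (snd z) * d (snd z))" for z
    by (simp add: tensor_apply)
  then show ?thesis
    unfolding L2_inner_def
    using integral_tensor(2)[OF L2_space_mult_integrable[OF assms(1,2)] L2_space_mult_integrable[OF assms(3,4)]]
    by simp
qed

lemma (in pair_sigma_finite) tensor_L2_space:
  assumes "a \<in> L2_space M1" "b \<in> L2_space M2"
  shows "tensor a b \<in> L2_space (M1 \<Otimes>\<^sub>M M2)"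
proof -
  note [measurable] = L2_spaceD(1)[OF assms(1)] L2_spaceD(1)[OF assms(2)]
  have "tensor a b \<in> borel_measurable (M1 \<Otimes>\<^sub>M M2)"
    unfolding tensor_def by measurable
  moreover have "integrable (M1 \<Otimes>\<^sub>M M2) (\<lambda>z. (tensor a b z)\<^sup>2)"
    using integral_tensor(1)[OF L2_spaceD(2)[OF assms(1)] L2_spaceD(2)[OF assms(2)]]
    by (simp add: tensor_apply power_mult_distrib)
  ultimately show ?thesis by (simp add: L2_space_def)
qed

lemma L2_inner_commute: "L2_inner M f g = L2_inner M g f"
  by (simp add: L2_inner_def mult.commute)

lemma L2_inner_diff_left:
  assumes "f \<in> L2_space M" "g \<in> L2_space M" "u \<in> L2_space M"
  shows "L2_inner M (\<lambda>x. f x - g x) u = L2_inner M f u - L2_inner M g u"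
  unfolding L2_inner_def
  using L2_space_mult_integrable[OF assms(1,3)] L2_space_mult_integrable[OF assms(2,3)]
  by (simp add: left_diff_distrib)

lemma L2_inner_sum_right:
  assumes "f \<in> L2_space M" "\<And>i. i \<in> I \<Longrightarrow> u i \<in> L2_space M"
  shows "L2_inner M f (\<lambda>x. \<Sum>i\<in>I. c i * u i x) = (\<Sum>i\<in>I. c i * L2_inner M f (u i))"
proof -
  have "L2_inner M f (\<lambda>x. \<Sum>i\<in>I. c i * u i x) = (\<integral>x. (\<Sum>i\<in>I. c i * (f x * u i x)) \<partial>M)"
    unfolding L2_inner_def by (simp add: sum_distrib_left mult.left_commute)
  also have "\<dots> = (\<Sum>i\<in>I. c i * L2_inner M f (u i))"
    unfolding L2_inner_def using L2_space_mult_integrable[OF assms(1) assms(2)]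
    by (subst Bochner_Integration.integral_sum) auto
  finally show ?thesis .
qed

text \<open>The squared norm of \<open>f\<close> minus its projection \<open>p\<close> onto the span
  of the finite family is nonnegative, and it equals the difference of the two sides.\<close>

lemma L2_Bessel_inequality:
  assumes f: "f \<in> L2_space M" and fin: "finite I" and u: "\<And>i. i \<in> I \<Longrightarrow> u i \<in> L2_space M"
    and orth: "\<And>i j. i \<in> I \<Longrightarrow> j \<in> I \<Longrightarrow> L2_inner M (u i) (u j) = (if i = j then 1 else 0)"
  shows "(\<Sum>i\<in>I. (L2_inner M f (u i))\<^sup>2) \<le> L2_inner M f f"
proof -
  define c where "c i = L2_inner M f (u i)" for i
  define p where "p = (\<lambda>x. \<Sum>i\<in>I. c i * u i x)"
  have p: "p \<in> L2_space M" unfolding p_def by (rule L2_space_sum[OF u])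
  have fp: "L2_inner M f p = (\<Sum>i\<in>I. (c i)\<^sup>2)"
    unfolding p_def by (subst L2_inner_sum_right[OF f u]) (auto simp: c_def power2_eq_square)
  have pu: "L2_inner M p (u j) = c j" if "j \<in> I" for j
  proof -
    have "L2_inner M p (u j) = (\<Sum>i\<in>I. c i * L2_inner M (u j) (u i))"
      unfolding L2_inner_commute[of M p "u j"] unfolding p_def
      by (rule L2_inner_sum_right[OF u[OF that] u])
    also have "\<dots> = (\<Sum>i\<in>I. if j = i then c i else 0)"
      by (intro sum.cong) (auto simp: orth[OF that])
    finally show ?thesis using fin that by simp
  qed
  have pp: "L2_inner M p p = (\<Sum>i\<in>I. (c i)\<^sup>2)"
  proof -
    have "L2_inner M p p = (\<Sum>i\<in>I. c i * L2_inner M p (u i))"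
      by (subst (2) p_def) (rule L2_inner_sum_right[OF p u])
    then show ?thesis by (simp add: pu power2_eq_square)
  qed
  have d: "(\<lambda>x. f x - p x) \<in> L2_space M" by (rule L2_space_diff[OF f p])
  have fd: "L2_inner M f (\<lambda>x. f x - p x) = L2_inner M f f - L2_inner M p f"
    using L2_inner_diff_left[OF f p f] by (subst L2_inner_commute)
  have pd: "L2_inner M p (\<lambda>x. f x - p x) = L2_inner M f p - L2_inner M p p"
    using L2_inner_diff_left[OF f p p] by (subst L2_inner_commute)
  have "0 \<le> L2_inner M (\<lambda>x. f x - p x) (\<lambda>x. f x - p x)" by (rule L2_inner_self_nonneg)
  also have "\<dots> = L2_inner M f f - L2_inner M p f - (L2_inner M f p - L2_inner M p p)"
    unfolding L2_inner_diff_left[OF f p d] fd pd ..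
  also have "\<dots> = L2_inner M f f - (\<Sum>i\<in>I. (c i)\<^sup>2)"
    by (simp add: fp pp L2_inner_commute[of M p f])
  finally show ?thesis by (simp add: c_def)
qed

section \<open>The maps phi^(1,1) and phi^(2)\<close>

text \<open>Two centered families drive the series, \<open>X j\<close> for phi^(1,1) and
  \<open>X j ^ 2 - 1\<close> for phi^(2); a single constant \<open>K\<close> bounds the fourth
  moments of both.\<close>

locale chaos = prob_space \<nu> + base: prob_space \<mu>
  for \<nu> :: "'e measure" and \<mu> :: "real measure" +
  fixes X :: "nat \<Rightarrow> 'e \<Rightarrow> real" and e :: "nat \<Rightarrow> real \<Rightarrow> real" and K :: real
  assumes ind: "indep_vars (\<lambda>_. borel) X {1..}"
    and K: "K \<ge> 1"
    and X4: "\<And>j. j \<ge> 1 \<Longrightarrow> X j \<in> L4_space \<nu>"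
    and EX: "\<And>j. j \<ge> 1 \<Longrightarrow> (\<integral>\<omega>. X j \<omega> \<partial>\<nu>) = 0"
    and EX4: "\<And>j. j \<ge> 1 \<Longrightarrow> (\<integral>\<omega>. X j \<omega> ^ 4 \<partial>\<nu>) \<le> K"
    and Q4: "\<And>j. j \<ge> 1 \<Longrightarrow> (\<lambda>\<omega>. (X j \<omega>)\<^sup>2 - 1) \<in> L4_space \<nu>"
    and EQ: "\<And>j. j \<ge> 1 \<Longrightarrow> (\<integral>\<omega>. (X j \<omega>)\<^sup>2 - 1 \<partial>\<nu>) = 0"
    and EQ4: "\<And>j. j \<ge> 1 \<Longrightarrow> (\<integral>\<omega>. ((X j \<omega>)\<^sup>2 - 1) ^ 4 \<partial>\<nu>) \<le> K"
    and e_L2: "\<And>j. j \<ge> 1 \<Longrightarrow> e j \<in> L2_space \<mu>"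
    and e_orth: "\<And>i j. i \<ge> 1 \<Longrightarrow> j \<ge> 1 \<Longrightarrow> L2_inner \<mu> (e i) (e j) = (if i = j then 1 else 0)"
begin

sublocale prod: pair_sigma_finite \<mu> \<mu> ..

definition coeff :: "(real \<times> real \<Rightarrow> real) \<Rightarrow> nat \<Rightarrow> nat \<Rightarrow> real" where
  "coeff f j k = L2_inner (\<mu> \<Otimes>\<^sub>M \<mu>) f (tensor (e j) (e k))"

lemma tensor_e_L2: "j \<ge> 1 \<Longrightarrow> k \<ge> 1 \<Longrightarrow> tensor (e j) (e k) \<in> L2_space (\<mu> \<Otimes>\<^sub>M \<mu>)"
  by (intro prod.tensor_L2_space e_L2)

lemma tensor_e_orth:
  assumes "j \<ge> 1" "k \<ge> 1" "j' \<ge> 1" "k' \<ge> 1"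
  shows "L2_inner (\<mu> \<Otimes>\<^sub>M \<mu>) (tensor (e j) (e k)) (tensor (e j') (e k')) = (if (j, k) = (j', k') then 1 else 0)"
  using assms by (subst prod.L2_inner_tensor) (auto simp: e_L2 e_orth)

lemma coeff_diff:
  assumes "f \<in> L2_space (\<mu> \<Otimes>\<^sub>M \<mu>)" "g \<in> L2_space (\<mu> \<Otimes>\<^sub>M \<mu>)" "j \<ge> 1" "k \<ge> 1"
  shows "coeff (\<lambda>z. f z - g z) j k = coeff f j k - coeff g j k"
  unfolding coeff_def by (rule L2_inner_diff_left[OF assms(1,2) tensor_e_L2[OF assms(3,4)]])

text \<open>The products of basis functions are orthonormal in the product space because inner
  products of tensors factor. Indices start at 1, as \<open>e 0\<close> is arbitrary.\<close>

lemma coeff_Bessel: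
  assumes f: "f \<in> L2_space (\<mu> \<Otimes>\<^sub>M \<mu>)" and I: "finite I" "I \<subseteq> {1..} \<times> {1..}"
  shows "(\<Sum>(j, k)\<in>I. (coeff f j k)\<^sup>2) \<le> L2_inner (\<mu> \<Otimes>\<^sub>M \<mu>) f f"
proof -
  have "(\<Sum>i\<in>I. (L2_inner (\<mu> \<Otimes>\<^sub>M \<mu>) f (tensor (e (fst i)) (e (snd i))))\<^sup>2) \<le> L2_inner (\<mu> \<Otimes>\<^sub>M \<mu>) f f"
  proof (rule L2_Bessel_inequality[OF f I(1)])
    show "tensor (e (fst i)) (e (snd i)) \<in> L2_space (\<mu> \<Otimes>\<^sub>M \<mu>)" if "i \<in> I" for i
      by (rule tensor_e_L2) (use that I in auto)
    show "L2_inner (\<mu> \<Otimes>\<^sub>M \<mu>) (tensor (e (fst i)) (e (snd i))) (tensor (e (fst i')) (e (snd i'))) = (if i = i' then 1 else 0)"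
      if "i \<in> I" "i' \<in> I" for i i'
      by (subst tensor_e_orth) (use that I in \<open>auto simp: prod_eq_iff\<close>)
  qed
  then show ?thesis by (simp add: coeff_def split_beta)
qed

definition partial11 :: "(real \<times> real \<Rightarrow> real) \<Rightarrow> nat \<Rightarrow> 'e \<Rightarrow> real" where
  "partial11 f n \<omega> = (\<Sum>j=2..n. (\<Sum>k=1..<j. coeff f j k * X k \<omega>) * X j \<omega>)"

definition partial2 :: "(real \<times> real \<Rightarrow> real) \<Rightarrow> nat \<Rightarrow> 'e \<Rightarrow> real" where
  "partial2 f n \<omega> = (\<Sum>j=1..n. coeff f j j * ((X j \<omega>)\<^sup>2 - 1))"

lemma sum_tail_diff:
  fixes f :: "nat \<Rightarrow> real"
  assumes "m \<le> n"
  shows "(\<Sum>j\<in>{0<..n}. f j) - (\<Sum>j\<in>{0<..m}. f j) = (\<Sum>j\<in>{m<..n}. f j)"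
proof -
  have "{0<..n} = {0<..m} \<union> {m<..n}" using assms by auto
  moreover have "{0<..m} \<inter> {m<..n} = {}" by auto
  ultimately show ?thesis by (simp add: sum.union_disjoint)
qed

text \<open>The term \<open>j = 1\<close> has an empty inner sum, so starting at 1 changes nothing
  and gives the left-open interval of the moment bounds.\<close>

lemma partial11_eq:
  "partial11 f n \<omega> = (\<Sum>j\<in>{0<..n}. (\<Sum>k=1..<j. coeff f j k * X k \<omega>) * X j \<omega>)"
  unfolding partial11_def by (rule sum.mono_neutral_left) auto

lemma partial2_eq:
  "partial2 f n \<omega> = (\<Sum>j\<in>{0<..n}. coeff f j j * ((X j \<omega>)\<^sup>2 - 1))"
  unfolding partial2_def by (rule sum.cong) auto

lemma coeff11_sum_le:
  assumes "f \<in> L2_space (\<mu> \<Otimes>\<^sub>M \<mu>)" "finite J"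
  shows "(\<Sum>j\<in>J. \<Sum>k=1..<j. (coeff f j k)\<^sup>2) \<le> L2_inner (\<mu> \<Otimes>\<^sub>M \<mu>) f f"
proof -
  have "(\<Sum>j\<in>J. \<Sum>k=1..<j. (coeff f j k)\<^sup>2) = (\<Sum>(j, k)\<in>Sigma J (\<lambda>j. {1..<j}). (coeff f j k)\<^sup>2)"
    using assms by (subst sum.Sigma) auto
  also have "\<dots> \<le> L2_inner (\<mu> \<Otimes>\<^sub>M \<mu>) f f"
    using assms by (intro coeff_Bessel) auto
  finally show ?thesis .
qed

text \<open>Bessel's inequality over the diagonal pairs. Index 0 must be excluded because
  \<open>coeff f 0 0\<close> involves the arbitrary function \<open>e 0\<close>.\<close>

lemma coeff2_sum_le:
  assumes "f \<in> L2_space (\<mu> \<Otimes>\<^sub>M \<mu>)" "finite J" "0 \<notin> J"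
  shows "(\<Sum>j\<in>J. (coeff f j j)\<^sup>2) \<le> L2_inner (\<mu> \<Otimes>\<^sub>M \<mu>) f f"
proof -
  have "(\<Sum>j\<in>J. (coeff f j j)\<^sup>2) = (\<Sum>(j, k)\<in>(\<lambda>j. (j, j)) ` J. (coeff f j k)\<^sup>2)"
    by (subst sum.reindex) (auto simp: inj_on_def)
  also have "\<dots> \<le> L2_inner (\<mu> \<Otimes>\<^sub>M \<mu>) f f"
    using assms by (intro coeff_Bessel) (auto simp: Suc_le_eq intro!: gr0I)
  finally show ?thesis .
qed

lemma moment11:
  "(\<lambda>\<omega>. \<Sum>j\<in>{m<..n}. (\<Sum>k=1..<j. a j k * X k \<omega>) * X j \<omega>) \<in> L4_space \<nu>"
  "(\<integral>\<omega>. (\<Sum>j\<in>{m<..n}. (\<Sum>k=1..<j. a j k * X k \<omega>) * X j \<omega>) ^ 4 \<partial>\<nu>)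
    \<le> 256 * K ^ 4 * (\<Sum>j\<in>{m<..n}. \<Sum>k=1..<j. (a j k)\<^sup>2)\<^sup>2"
  by (rule fourth_moment_quadratic[OF ind X4 EX EX4 K]; assumption)+

lemma moment2:
  "(\<lambda>\<omega>. \<Sum>j\<in>{m<..n}. a j * ((X j \<omega>)\<^sup>2 - 1)) \<in> L4_space \<nu>"
  "(\<integral>\<omega>. (\<Sum>j\<in>{m<..n}. a j * ((X j \<omega>)\<^sup>2 - 1)) ^ 4 \<partial>\<nu>) \<le> 16 * K\<^sup>2 * (\<Sum>j\<in>{m<..n}. (a j)\<^sup>2)\<^sup>2"
  by (rule fourth_moment_linear[where y="\<lambda>x. x\<^sup>2 - 1", OF ind _ Q4 EQ EQ4 K]; simp)+

text \<open>Bessel's inequality makes the row sums of squared coefficients summable, and the fourth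
  moment of a block of terms is bounded by the square of the corresponding block of row sums. Hence
  some limit exists, which is exactly what the choice in \<open>phi11\<close> requires.\<close>

lemma phi11_L2_tendsto:
  assumes f: "f \<in> L2_space (\<mu> \<Otimes>\<^sub>M \<mu>)"
  shows "L2_tendsto \<nu> (partial11 f) (phi11 \<nu> X \<mu> e f)"
proof -
  have "\<exists>Y. L2_tendsto \<nu> (partial11 f) Y"
  proof (rule L2_limit_exists_of_summable)
    show "partial11 f n \<in> L4_space \<nu>" for n
      using moment11(1) by (rule L4_space_cong) (rule partial11_eq)
    show "0 \<le> 256 * K ^ 4" by simp
    show "0 \<le> (\<Sum>k=1..<j. (coeff f j k)\<^sup>2)" for j by (simp add: sum_nonneg)
    show "summable (\<lambda>j. \<Sum>k=1..<j. (coeff f j k)\<^sup>2)"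
      by (rule summableI_nonneg_bounded[OF _ coeff11_sum_le[OF f finite_lessThan]]) (simp add: sum_nonneg)
    show "(\<integral>\<omega>. (partial11 f n \<omega> - partial11 f m \<omega>) ^ 4 \<partial>\<nu>)
      \<le> 256 * K ^ 4 * (\<Sum>j\<in>{m<..n}. \<Sum>k=1..<j. (coeff f j k)\<^sup>2)\<^sup>2" if "m \<le> n" for m n
      unfolding partial11_eq sum_tail_diff[OF that] by (rule moment11(2))
  qed
  then show ?thesis
    unfolding phi11_def partial11_def[abs_def] coeff_def by (rule someI_ex)
qed

lemma phi2_L2_tendsto:
  assumes f: "f \<in> L2_space (\<mu> \<Otimes>\<^sub>M \<mu>)"
  shows "L2_tendsto \<nu> (partial2 f) (phi2 \<nu> X \<mu> e f)"
proof -
  have "\<exists>Y. L2_tendsto \<nu> (partial2 f) Y"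
  proof (rule L2_limit_exists_of_summable)
    show "partial2 f n \<in> L4_space \<nu>" for n
      using moment2(1) by (rule L4_space_cong) (rule partial2_eq)
    show "0 \<le> 16 * K\<^sup>2" by simp
    \<comment> \<open>\<open>coeff f 0 0\<close> is not controlled, and no block
      \<open>{m<..n}\<close> contains 0.\<close>
    define \<alpha> where "\<alpha> j = (if j = 0 then 0 else (coeff f j j)\<^sup>2)" for j
    show "0 \<le> \<alpha> j" for j by (simp add: \<alpha>_def)
    show "summable \<alpha>"
    proof (rule summableI_nonneg_bounded[where x="L2_inner (\<mu> \<Otimes>\<^sub>M \<mu>) f f"])
      show "(\<Sum>j<n. \<alpha> j) \<le> L2_inner (\<mu> \<Otimes>\<^sub>M \<mu>) f f" for n
      proof -
        have "(\<Sum>j<n. \<alpha> j) = (\<Sum>j\<in>{..<n} - {0}. (coeff f j j)\<^sup>2)"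
          unfolding \<alpha>_def by (rule sum.mono_neutral_cong_right) auto
        then show ?thesis using coeff2_sum_le[OF f, of "{..<n} - {0}"] by simp
      qed
    qed (simp add: \<alpha>_def)
    show "(\<integral>\<omega>. (partial2 f n \<omega> - partial2 f m \<omega>) ^ 4 \<partial>\<nu>)
      \<le> 16 * K\<^sup>2 * (\<Sum>j\<in>{m<..n}. \<alpha> j)\<^sup>2" if "m \<le> n" for m n
    proof -
      have "(\<Sum>j\<in>{m<..n}. \<alpha> j) = (\<Sum>j\<in>{m<..n}. (coeff f j j)\<^sup>2)"
        unfolding \<alpha>_def by (rule sum.cong) auto
      then show ?thesis
        unfolding partial2_eq sum_tail_diff[OF that] using moment2(2) by simp
    qed
  qed
  then show ?thesis
    unfolding phi2_def partial2_def[abs_def] coeff_def by (rule someI_ex)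
qed

text \<open>The versions for \<open>f\<close>, \<open>g\<close> and \<open>f - g\<close> are chosen
  separately, so no pointwise linearity is available for them. The partial sums are linear, and the
  bound is proved there for the kernel \<open>f - g\<close> before passing to the limit.\<close>

lemma phi11_diff_fourth_moment:
  assumes f: "f \<in> L2_space (\<mu> \<Otimes>\<^sub>M \<mu>)" and g: "g \<in> L2_space (\<mu> \<Otimes>\<^sub>M \<mu>)"
  defines "D \<equiv> L2_inner (\<mu> \<Otimes>\<^sub>M \<mu>) (\<lambda>z. f z - g z) (\<lambda>z. f z - g z)"
  shows "(\<lambda>\<omega>. phi11 \<nu> X \<mu> e f \<omega> - phi11 \<nu> X \<mu> e g \<omega>) \<in> L4_space \<nu>"
    "(\<integral>\<omega>. (phi11 \<nu> X \<mu> e f \<omega> - phi11 \<nu> X \<mu> e g \<omega>) ^ 4 \<partial>\<nu>) \<le> 256 * K ^ 4 * D\<^sup>2"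
proof -
  let ?h = "\<lambda>z. f z - g z"
  have h: "?h \<in> L2_space (\<mu> \<Otimes>\<^sub>M \<mu>)" by (rule L2_space_diff[OF f g])
  have eq: "partial11 f n \<omega> - partial11 g n \<omega> = (\<Sum>j\<in>{0<..n}. (\<Sum>k=1..<j. coeff ?h j k * X k \<omega>) * X j \<omega>)" for n \<omega>
    unfolding partial11_eq
    by (simp add: coeff_diff[OF f g] left_diff_distrib sum_subtractf)
  have le: "(\<integral>\<omega>. (partial11 f n \<omega> - partial11 g n \<omega>) ^ 4 \<partial>\<nu>) \<le> 256 * K ^ 4 * D\<^sup>2" for n
  proof -
    have "(\<integral>\<omega>. (partial11 f n \<omega> - partial11 g n \<omega>) ^ 4 \<partial>\<nu>)
      \<le> 256 * K ^ 4 * (\<Sum>j\<in>{0<..n}. \<Sum>k=1..<j. (coeff ?h j k)\<^sup>2)\<^sup>2"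
      unfolding eq by (rule moment11(2))
    also have "\<dots> \<le> 256 * K ^ 4 * D\<^sup>2"
      unfolding D_def by (intro mult_left_mono power_mono coeff11_sum_le[OF h]) (auto simp: sum_nonneg)
    finally show ?thesis .
  qed
  have L4: "(\<lambda>\<omega>. partial11 f n \<omega> - partial11 g n \<omega>) \<in> L4_space \<nu>" for n
    unfolding eq by (rule moment11(1))
  show "(\<lambda>\<omega>. phi11 \<nu> X \<mu> e f \<omega> - phi11 \<nu> X \<mu> e g \<omega>) \<in> L4_space \<nu>"
    "(\<integral>\<omega>. (phi11 \<nu> X \<mu> e f \<omega> - phi11 \<nu> X \<mu> e g \<omega>) ^ 4 \<partial>\<nu>) \<le> 256 * K ^ 4 * D\<^sup>2"
    by (rule fourth_moment_L2_limit_diff[OF phi11_L2_tendsto[OF f] phi11_L2_tendsto[OF g] L4 le])+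
qed

lemma phi2_diff_fourth_moment:
  assumes f: "f \<in> L2_space (\<mu> \<Otimes>\<^sub>M \<mu>)" and g: "g \<in> L2_space (\<mu> \<Otimes>\<^sub>M \<mu>)"
  defines "D \<equiv> L2_inner (\<mu> \<Otimes>\<^sub>M \<mu>) (\<lambda>z. f z - g z) (\<lambda>z. f z - g z)"
  shows "(\<lambda>\<omega>. phi2 \<nu> X \<mu> e f \<omega> - phi2 \<nu> X \<mu> e g \<omega>) \<in> L4_space \<nu>"
    "(\<integral>\<omega>. (phi2 \<nu> X \<mu> e f \<omega> - phi2 \<nu> X \<mu> e g \<omega>) ^ 4 \<partial>\<nu>) \<le> 16 * K\<^sup>2 * D\<^sup>2"
proof -
  let ?h = "\<lambda>z. f z - g z"
  have h: "?h \<in> L2_space (\<mu> \<Otimes>\<^sub>M \<mu>)" by (rule L2_space_diff[OF f g])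
  have eq: "partial2 f n \<omega> - partial2 g n \<omega> = (\<Sum>j\<in>{0<..n}. coeff ?h j j * ((X j \<omega>)\<^sup>2 - 1))" for n \<omega>
    unfolding partial2_eq sum_subtractf[symmetric]
    by (intro sum.cong) (auto simp: coeff_diff[OF f g] left_diff_distrib)
  have le: "(\<integral>\<omega>. (partial2 f n \<omega> - partial2 g n \<omega>) ^ 4 \<partial>\<nu>) \<le> 16 * K\<^sup>2 * D\<^sup>2" for n
  proof -
    have "(\<integral>\<omega>. (partial2 f n \<omega> - partial2 g n \<omega>) ^ 4 \<partial>\<nu>) \<le> 16 * K\<^sup>2 * (\<Sum>j\<in>{0<..n}. (coeff ?h j j)\<^sup>2)\<^sup>2"
      unfolding eq by (rule moment2(2))
    also have "\<dots> \<le> 16 * K\<^sup>2 * D\<^sup>2"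
      unfolding D_def by (intro mult_left_mono power_mono coeff2_sum_le[OF h]) (auto simp: sum_nonneg)
    finally show ?thesis .
  qed
  have L4: "(\<lambda>\<omega>. partial2 f n \<omega> - partial2 g n \<omega>) \<in> L4_space \<nu>" for n
    unfolding eq by (rule moment2(1))
  show "(\<lambda>\<omega>. phi2 \<nu> X \<mu> e f \<omega> - phi2 \<nu> X \<mu> e g \<omega>) \<in> L4_space \<nu>"
    "(\<integral>\<omega>. (phi2 \<nu> X \<mu> e f \<omega> - phi2 \<nu> X \<mu> e g \<omega>) ^ 4 \<partial>\<nu>) \<le> 16 * K\<^sup>2 * D\<^sup>2"
    by (rule fourth_moment_L2_limit_diff[OF phi2_L2_tendsto[OF f] phi2_L2_tendsto[OF g] L4 le])+
qed

end

section \<open>Kernels of the integral and its increments\<close>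

lemma L2_space_mult_indicator:
  assumes "f \<in> L2_space M" "A \<in> sets M"
  shows "(\<lambda>x. f x * indicator A x) \<in> L2_space M"
proof -
  have "integrable M (\<lambda>x. indicator A x * (f x)\<^sup>2)"
    using integrable_mult_indicator[OF assms(2) L2_spaceD(2)[OF assms(1)]] by simp
  moreover have "(f x * indicator A x)\<^sup>2 = indicator A x * (f x)\<^sup>2" for x :: 'a
    by (simp add: indicator_def)
  ultimately show ?thesis
    using assms by (auto simp: L2_space_def)
qed

lemma L2_inner_self_mono:
  assumes "f \<in> L2_space M" "g \<in> L2_space M" "\<And>x. (f x)\<^sup>2 \<le> (g x)\<^sup>2"
  shows "L2_inner M f f \<le> L2_inner M g g"
  unfolding L2_inner_self
  by (rule integral_mono) (use assms in \<open>auto simp: L2_space_def\<close>)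

lemma L2_inner_self_add_le:
  assumes "f \<in> L2_space M" "g \<in> L2_space M"
  shows "L2_inner M (\<lambda>x. f x + g x) (\<lambda>x. f x + g x) \<le> 2 * L2_inner M f f + 2 * L2_inner M g g"
proof -
  have "L2_inner M (\<lambda>x. f x + g x) (\<lambda>x. f x + g x) \<le> (\<integral>x. 2 * (f x)\<^sup>2 + 2 * (g x)\<^sup>2 \<partial>M)"
    unfolding L2_inner_self
  proof (rule integral_mono)
    show "integrable M (\<lambda>x. (f x + g x)\<^sup>2)" by (rule L2_spaceD(2)[OF L2_space_add[OF assms]])
    show "integrable M (\<lambda>x. 2 * (f x)\<^sup>2 + 2 * (g x)\<^sup>2)"
      using L2_spaceD(2)[OF assms(1)] L2_spaceD(2)[OF assms(2)] by auto
    show "(f x + g x)\<^sup>2 \<le> 2 * (f x)\<^sup>2 + 2 * (g x)\<^sup>2" for x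
      using sum_squares_bound[of "f x" "g x"] by (simp add: power2_sum)
  qed
  also have "\<dots> = 2 * L2_inner M f f + 2 * L2_inner M g g"
    unfolding L2_inner_self using L2_spaceD(2)[OF assms(1)] L2_spaceD(2)[OF assms(2)] by simp
  finally show ?thesis .
qed

lemma sets_triangle: "triangle \<in> sets borel" "triangle' \<in> sets borel"
proof -
  have le: "{z :: real \<times> real. f z \<le> g z} \<in> sets borel"
    if "continuous_on UNIV f" "continuous_on UNIV g" for f g :: "real \<times> real \<Rightarrow> real"
    by (rule borel_closed) (rule closed_Collect_le[OF that])
  have less: "{z :: real \<times> real. f z < g z} \<in> sets borel"
    if "continuous_on UNIV f" "continuous_on UNIV g" for f g :: "real \<times> real \<Rightarrow> real"
    by (rule borel_open) (rule open_Collect_less[OF that])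
  have "triangle = {z. 0 \<le> fst z} \<inter> {z. fst z < snd z} \<inter> {z. snd z \<le> 1}"
    unfolding triangle_def by auto
  also have "\<dots> \<in> sets borel" by (intro sets.Int le less continuous_intros)
  finally show "triangle \<in> sets borel" .
  have "triangle' = {z. 0 \<le> snd z} \<inter> {z. snd z < fst z} \<inter> {z. fst z \<le> 1}"
    unfolding triangle'_def by auto
  also have "\<dots> \<in> sets borel" by (intro sets.Int le less continuous_intros)
  finally show "triangle' \<in> sets borel" .
qed

context chaos
begin

definition kernel11 :: "(real \<Rightarrow> real) \<Rightarrow> (real \<Rightarrow> real) \<Rightarrow> real \<times> real \<Rightarrow> real" where
  "kernel11 h g = (\<lambda>z. tensor h g z * indicator triangle z + tensor g h z * indicator triangle' z)"

definition kernel2 :: "(real \<Rightarrow> real) \<Rightarrow> (real \<Rightarrow> real) \<Rightarrow> real \<times> real \<Rightarrow> real" where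
  "kernel2 h g = (\<lambda>z. tensor h g z * indicator triangle z)"

text \<open>Norms of tensors multiply and cutting to a triangle only decreases them. The factor 4 is
  2 + 2, from (a + b)^2 <= 2 a^2 + 2 b^2 for the two triangles.\<close>

lemma kernels:
  assumes \<mu>: "sets \<mu> = sets borel" and h: "h \<in> L2_space \<mu>" and g: "g \<in> L2_space \<mu>"
  shows "kernel11 h g \<in> L2_space (\<mu> \<Otimes>\<^sub>M \<mu>)" "kernel2 h g \<in> L2_space (\<mu> \<Otimes>\<^sub>M \<mu>)"
    and "L2_inner (\<mu> \<Otimes>\<^sub>M \<mu>) (kernel11 h g) (kernel11 h g) \<le> 4 * (L2_inner \<mu> h h * L2_inner \<mu> g g)"
    and "L2_inner (\<mu> \<Otimes>\<^sub>M \<mu>) (kernel2 h g) (kernel2 h g) \<le> L2_inner \<mu> h h * L2_inner \<mu> g g"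
proof -
  have "sets (\<mu> \<Otimes>\<^sub>M \<mu>) = sets (borel :: (real \<times> real) measure)"
    unfolding borel_prod[symmetric] using \<mu> by (intro sets_pair_measure_cong) auto
  then have T: "triangle \<in> sets (\<mu> \<Otimes>\<^sub>M \<mu>)" "triangle' \<in> sets (\<mu> \<Otimes>\<^sub>M \<mu>)"
    using sets_triangle by auto
  have t1: "tensor h g \<in> L2_space (\<mu> \<Otimes>\<^sub>M \<mu>)" and t2: "tensor g h \<in> L2_space (\<mu> \<Otimes>\<^sub>M \<mu>)"
    by (intro prod.tensor_L2_space h g)+
  note i1 = L2_space_mult_indicator[OF t1 T(1)] and i2 = L2_space_mult_indicator[OF t2 T(2)]
  have n: "L2_inner (\<mu> \<Otimes>\<^sub>M \<mu>) (tensor h g) (tensor h g) = L2_inner \<mu> h h * L2_inner \<mu> g g"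
    "L2_inner (\<mu> \<Otimes>\<^sub>M \<mu>) (tensor g h) (tensor g h) = L2_inner \<mu> h h * L2_inner \<mu> g g"
    using prod.L2_inner_tensor[OF h h g g] prod.L2_inner_tensor[OF g g h h] by simp_all
  have le: "L2_inner (\<mu> \<Otimes>\<^sub>M \<mu>) (\<lambda>z. f z * indicator A z) (\<lambda>z. f z * indicator A z) \<le> L2_inner (\<mu> \<Otimes>\<^sub>M \<mu>) f f"
    if "f \<in> L2_space (\<mu> \<Otimes>\<^sub>M \<mu>)" "A \<in> sets (\<mu> \<Otimes>\<^sub>M \<mu>)" for f A
    by (rule L2_inner_self_mono[OF L2_space_mult_indicator[OF that] that(1)]) (simp add: indicator_def)
  show "kernel11 h g \<in> L2_space (\<mu> \<Otimes>\<^sub>M \<mu>)" unfolding kernel11_def by (rule L2_space_add[OF i1 i2])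
  show "kernel2 h g \<in> L2_space (\<mu> \<Otimes>\<^sub>M \<mu>)" unfolding kernel2_def by (rule i1)
  show "L2_inner (\<mu> \<Otimes>\<^sub>M \<mu>) (kernel11 h g) (kernel11 h g) \<le> 4 * (L2_inner \<mu> h h * L2_inner \<mu> g g)"
    using L2_inner_self_add_le[OF i1 i2] le[OF t1 T(1)] le[OF t2 T(2)] unfolding kernel11_def n by linarith
  show "L2_inner (\<mu> \<Otimes>\<^sub>M \<mu>) (kernel2 h g) (kernel2 h g) \<le> L2_inner \<mu> h h * L2_inner \<mu> g g"
    using le[OF t1 T(1)] unfolding kernel2_def n .
qed

lemma Phi_integral_eq:
  "Phi_integral \<nu> X \<mu> e h g \<omega> = phi11 \<nu> X \<mu> e (kernel11 h g) \<omega> + phi2 \<nu> X \<mu> e (kernel2 h g) \<omega>"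
  by (simp add: Phi_integral_def kernel11_def kernel2_def)

text \<open>Linearity in the integrator: an increment in time becomes the kernel of one function
  \<open>g - g'\<close>, whose norm is then explicit.\<close>

lemma kernel_diff:
  "kernel11 h g z - kernel11 h g' z = kernel11 h (\<lambda>x. g x - g' x) z"
  "kernel2 h g z - kernel2 h g' z = kernel2 h (\<lambda>x. g x - g' x) z"
  by (simp_all add: kernel11_def kernel2_def tensor_apply algebra_simps)

lemma Phi_integral_measurable:
  assumes "sets \<mu> = sets borel" "h \<in> L2_space \<mu>" "g \<in> L2_space \<mu>"
  shows "Phi_integral \<nu> X \<mu> e h g \<in> borel_measurable \<nu>"
proof -
  have "phi11 \<nu> X \<mu> e (kernel11 h g) \<in> borel_measurable \<nu>" "phi2 \<nu> X \<mu> e (kernel2 h g) \<in> borel_measurable \<nu>"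
    using phi11_L2_tendsto[OF kernels(1)[OF assms]] phi2_L2_tendsto[OF kernels(2)[OF assms]]
    by (auto simp: L2_tendsto_def L2_space_def)
  then show ?thesis unfolding Phi_integral_eq[abs_def] by (rule borel_measurable_add)
qed

text \<open>Origin of the constants: 4096 = 256 * 4^2, where 4 is the norm bound of
  \<open>kernel11\<close>; \<open>16 * K ^ 2\<close> belongs to phi^(2); the outer 8 is the cost of
  adding the two parts inside a fourth power.\<close>

lemma Phi_integral_diff_fourth_moment:
  assumes \<mu>: "sets \<mu> = sets borel" and h: "h \<in> L2_space \<mu>" and g: "g \<in> L2_space \<mu>" and g': "g' \<in> L2_space \<mu>"
  shows "(\<lambda>\<omega>. Phi_integral \<nu> X \<mu> e h g \<omega> - Phi_integral \<nu> X \<mu> e h g' \<omega>) \<in> L4_space \<nu>"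
    and "(\<integral>\<omega>. (Phi_integral \<nu> X \<mu> e h g \<omega> - Phi_integral \<nu> X \<mu> e h g' \<omega>) ^ 4 \<partial>\<nu>)
      \<le> 8 * (4096 * K ^ 4 + 16 * K\<^sup>2) * (L2_inner \<mu> h h)\<^sup>2
          * (L2_inner \<mu> (\<lambda>x. g x - g' x) (\<lambda>x. g x - g' x))\<^sup>2"
proof -
  define A where "A \<omega> = phi11 \<nu> X \<mu> e (kernel11 h g) \<omega> - phi11 \<nu> X \<mu> e (kernel11 h g') \<omega>" for \<omega>
  define B where "B \<omega> = phi2 \<nu> X \<mu> e (kernel2 h g) \<omega> - phi2 \<nu> X \<mu> e (kernel2 h g') \<omega>" for \<omega>
  define D where "D = L2_inner \<mu> h h * L2_inner \<mu> (\<lambda>x. g x - g' x) (\<lambda>x. g x - g' x)"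
  have D: "0 \<le> D" unfolding D_def by (intro mult_nonneg_nonneg L2_inner_self_nonneg)
  note d = L2_space_diff[OF g g']
  have A4: "A \<in> L4_space \<nu>"
    unfolding A_def[abs_def] by (intro phi11_diff_fourth_moment(1) kernels(1) \<mu> h g g')
  have B4: "B \<in> L4_space \<nu>"
    unfolding B_def[abs_def] by (intro phi2_diff_fourth_moment(1) kernels(2) \<mu> h g g')
  have EA: "(\<integral>\<omega>. A \<omega> ^ 4 \<partial>\<nu>) \<le> 256 * K ^ 4 * (4 * D)\<^sup>2"
  proof -
    have "(\<integral>\<omega>. A \<omega> ^ 4 \<partial>\<nu>) \<le> 256 * K ^ 4 *
       (L2_inner (\<mu> \<Otimes>\<^sub>M \<mu>) (kernel11 h (\<lambda>x. g x - g' x)) (kernel11 h (\<lambda>x. g x - g' x)))\<^sup>2"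
      unfolding A_def using phi11_diff_fourth_moment(2)[OF kernels(1)[OF \<mu> h g] kernels(1)[OF \<mu> h g']]
      unfolding kernel_diff .
    also have "\<dots> \<le> 256 * K ^ 4 * (4 * D)\<^sup>2"
      unfolding D_def by (intro mult_left_mono power_mono kernels(3)[OF \<mu> h d] L2_inner_self_nonneg) simp
    finally show ?thesis .
  qed
  have EB: "(\<integral>\<omega>. B \<omega> ^ 4 \<partial>\<nu>) \<le> 16 * K\<^sup>2 * D\<^sup>2"
  proof -
    have "(\<integral>\<omega>. B \<omega> ^ 4 \<partial>\<nu>) \<le> 16 * K\<^sup>2 *
       (L2_inner (\<mu> \<Otimes>\<^sub>M \<mu>) (kernel2 h (\<lambda>x. g x - g' x)) (kernel2 h (\<lambda>x. g x - g' x)))\<^sup>2"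
      unfolding B_def using phi2_diff_fourth_moment(2)[OF kernels(2)[OF \<mu> h g] kernels(2)[OF \<mu> h g']]
      unfolding kernel_diff .
    also have "\<dots> \<le> 16 * K\<^sup>2 * D\<^sup>2"
      unfolding D_def by (intro mult_left_mono power_mono kernels(4)[OF \<mu> h d] L2_inner_self_nonneg) simp
    finally show ?thesis .
  qed
  have eq: "Phi_integral \<nu> X \<mu> e h g \<omega> - Phi_integral \<nu> X \<mu> e h g' \<omega> = A \<omega> + B \<omega>" for \<omega>
    by (simp add: Phi_integral_eq A_def B_def)
  have AB: "(\<lambda>\<omega>. A \<omega> + B \<omega>) \<in> L4_space \<nu>" by (rule L4_space_add[OF A4 B4])
  then show "(\<lambda>\<omega>. Phi_integral \<nu> X \<mu> e h g \<omega> - Phi_integral \<nu> X \<mu> e h g' \<omega>) \<in> L4_space \<nu>"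
    unfolding eq .
  have "(\<integral>\<omega>. (A \<omega> + B \<omega>) ^ 4 \<partial>\<nu>) \<le> (\<integral>\<omega>. 8 * (A \<omega> ^ 4 + B \<omega> ^ 4) \<partial>\<nu>)"
    by (rule integral_mono[OF L4_spaceD(2)[OF AB] _ add_pow4_le])
       (use L4_spaceD(2)[OF A4] L4_spaceD(2)[OF B4] in auto)
  also have "\<dots> = 8 * ((\<integral>\<omega>. A \<omega> ^ 4 \<partial>\<nu>) + (\<integral>\<omega>. B \<omega> ^ 4 \<partial>\<nu>))"
    using L4_spaceD(2)[OF A4] L4_spaceD(2)[OF B4] by simp
  also have "\<dots> \<le> 8 * (256 * K ^ 4 * (4 * D)\<^sup>2 + 16 * K\<^sup>2 * D\<^sup>2)"
    using EA EB by simp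
  also have "\<dots> = 8 * (4096 * K ^ 4 + 16 * K\<^sup>2) * D\<^sup>2"
    by (simp add: power_mult_distrib algebra_simps)
  finally show "(\<integral>\<omega>. (Phi_integral \<nu> X \<mu> e h g \<omega> - Phi_integral \<nu> X \<mu> e h g' \<omega>) ^ 4 \<partial>\<nu>)
      \<le> 8 * (4096 * K ^ 4 + 16 * K\<^sup>2) * (L2_inner \<mu> h h)\<^sup>2
          * (L2_inner \<mu> (\<lambda>x. g x - g' x) (\<lambda>x. g x - g' x))\<^sup>2"
    unfolding eq D_def by (simp add: power_mult_distrib mult.assoc)
qed

end

section \<open>The clock of the process and the moments of the variables\<close>

text \<open>\<open>G\<close> is the distribution function of the finite measure with density h^2. On
  nonnegative times it differs by a constant from the integral of h^2 over ]0,t], and only its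
  increments matter. That measure is absolutely continuous with respect to the diffuse
  \<open>\<mu>\<close>, so it has no atoms and its distribution function is continuous.\<close>

lemma diffuse_energy_function:
  fixes \<mu> :: "real measure"
  assumes \<mu>: "sets \<mu> = sets borel" and diffuse: "\<And>x. emeasure \<mu> {x} = 0" and h: "h \<in> L2_space \<mu>"
  obtains G :: "real \<Rightarrow> real" where "continuous_on UNIV G" "mono G"
    "\<And>s t. 0 \<le> s \<Longrightarrow> 0 \<le> t \<Longrightarrow>
       L2_inner \<mu> (\<lambda>x. h x * indicator {0<..s} x - h x * indicator {0<..t} x)
         (\<lambda>x. h x * indicator {0<..s} x - h x * indicator {0<..t} x) = \<bar>G s - G t\<bar>"
proof -
  note [measurable] = L2_spaceD(1)[OF h]
  define m where "m = density \<mu> (\<lambda>x. ennreal ((h x)\<^sup>2))"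
  have em: "emeasure m A = ennreal (\<integral>x. (h x)\<^sup>2 * indicator A x \<partial>\<mu>)" if "A \<in> sets borel" for A
  proof -
    have A: "A \<in> sets \<mu>" using that \<mu> by simp
    have "emeasure m A = (\<integral>\<^sup>+x. ennreal ((h x)\<^sup>2) * indicator A x \<partial>\<mu>)"
      unfolding m_def using A by (subst emeasure_density) auto
    also have "\<dots> = (\<integral>\<^sup>+x. ennreal ((h x)\<^sup>2 * indicator A x) \<partial>\<mu>)"
      by (intro nn_integral_cong) (simp split: split_indicator)
    also have "\<dots> = ennreal (\<integral>x. (h x)\<^sup>2 * indicator A x \<partial>\<mu>)"
      using integrable_real_mult_indicator[OF A L2_spaceD(2)[OF h]]
      by (intro nn_integral_eq_integral) auto
    finally show ?thesis .
  qed
  have sets_m: "sets m = sets borel" unfolding m_def using \<mu> by simp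
  have "finite_measure m"
    by (rule finite_measureI) (use em[of UNIV] sets_eq_imp_space_eq[OF sets_m] in simp)
  then interpret m: finite_borel_measure m
    by (intro finite_borel_measure.intro finite_borel_measure_axioms.intro sets_m)
  have meas: "measure m A = (\<integral>x. (h x)\<^sup>2 * indicator A x \<partial>\<mu>)" if "A \<in> sets borel" for A
    unfolding measure_def em[OF that] by (simp add: integral_nonneg_AE)
  have point: "measure m {x} = 0" for x
  proof -
    have "AE y in \<mu>. y \<notin> {x}"
      using diffuse[of x] \<mu> by (intro AE_not_in) (auto simp: null_sets_def)
    then have "(\<integral>y. (h y)\<^sup>2 * indicator {x} y \<partial>\<mu>) = (\<integral>y. 0 \<partial>\<mu>)"
      using \<mu> by (intro integral_cong_AE) (auto elim!: eventually_mono)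
    then show ?thesis using meas[of "{x}"] by simp
  qed
  have diff: "L2_inner \<mu> (\<lambda>x. h x * indicator {0<..s} x - h x * indicator {0<..t} x)
         (\<lambda>x. h x * indicator {0<..s} x - h x * indicator {0<..t} x) = cdf m t - cdf m s"
    if "0 \<le> s" "s \<le> t" for s t
  proof (cases "s = t")
    case True
    then show ?thesis by (simp add: L2_inner_def)
  next
    case False
    then have "cdf m t - cdf m s = (\<integral>x. (h x)\<^sup>2 * indicator {s<..t} x \<partial>\<mu>)"
      using m.cdf_diff_eq[of s t] meas[of "{s<..t}"] that by simp
    \<comment> \<open>For \<open>0 <= s <= t\<close> the difference of the two truncations is
      \<open>- h\<close> on ]s,t] and 0 elsewhere; the sign disappears in the square.\<close>
    also have "\<dots> = L2_inner \<mu> (\<lambda>x. h x * indicator {0<..s} x - h x * indicator {0<..t} x)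
         (\<lambda>x. h x * indicator {0<..s} x - h x * indicator {0<..t} x)"
      unfolding L2_inner_self using that
      by (intro Bochner_Integration.integral_cong) (auto simp: indicator_def)
    finally show ?thesis by simp
  qed
  have mono: "cdf m s \<le> cdf m t" if "s \<le> t" for s t by (rule m.cdf_nondecreasing[OF that])
  show ?thesis
  proof (rule that[of "cdf m"])
    show "continuous_on UNIV (cdf m)"
      using m.isCont_cdf point by (simp add: continuous_at_imp_continuous_on)
    show "mono (cdf m)" using mono by (simp add: mono_def)
    show "L2_inner \<mu> (\<lambda>x. h x * indicator {0<..s} x - h x * indicator {0<..t} x)
         (\<lambda>x. h x * indicator {0<..s} x - h x * indicator {0<..t} x) = \<bar>cdf m s - cdf m t\<bar>"
      if "0 \<le> s" "0 \<le> t" for s t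
    proof (cases "s \<le> t")
      case True
      then show ?thesis using diff[OF that(1) True] mono[OF True] by simp
    next
      case False
      then have "t \<le> s" by simp
      have "L2_inner \<mu> (\<lambda>x. h x * indicator {0<..s} x - h x * indicator {0<..t} x)
         (\<lambda>x. h x * indicator {0<..s} x - h x * indicator {0<..t} x)
        = L2_inner \<mu> (\<lambda>x. h x * indicator {0<..t} x - h x * indicator {0<..s} x)
         (\<lambda>x. h x * indicator {0<..t} x - h x * indicator {0<..s} x)"
        unfolding L2_inner_self by (simp add: power2_commute)
      then show ?thesis using diff[OF that(2) \<open>t \<le> s\<close>] mono[OF \<open>t \<le> s\<close>] by simp
    qed
  qed
qed

text \<open>The fourth moment of \<open>X ^ 2 - 1\<close> is governed by the eighth moment of
  \<open>X\<close>. The factor 8 comes from \<open>add_pow4_le\<close>, and the estimate for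
  \<open>x ^ 4\<close> is weakened to the same majorant so that both families share one
  constant.\<close>

lemma (in prob_space) eighth_moment_consequences:
  fixes X :: "'a \<Rightarrow> real"
  assumes X[measurable]: "X \<in> borel_measurable M"
    and X8: "(\<integral>\<^sup>+\<omega>. ennreal (\<bar>X \<omega>\<bar> powr 8) \<partial>M) \<le> ennreal k" and k: "0 \<le> k"
  shows "X \<in> L4_space M" "(\<integral>\<omega>. X \<omega> ^ 4 \<partial>M) \<le> 8 * (k + 1)"
    and "(\<lambda>\<omega>. (X \<omega>)\<^sup>2 - 1) \<in> L4_space M" "(\<integral>\<omega>. ((X \<omega>)\<^sup>2 - 1) ^ 4 \<partial>M) \<le> 8 * (k + 1)"
proof -
  have p8: "\<bar>x\<bar> powr 8 = x ^ 8" for x :: real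
    by (cases "x = 0") (simp_all add: powr_numeral power_even_abs)
  have int: "integrable M (\<lambda>\<omega>. X \<omega> ^ 8)"
    by (rule integrableI_nonneg) (use X8 in \<open>auto simp: p8 less_top[symmetric] top_unique\<close>)
  have le: "(\<integral>\<omega>. X \<omega> ^ 8 \<partial>M) \<le> k"
    using X8 k by (simp add: p8 nn_integral_eq_integral[OF int])
  have intR: "integrable M (\<lambda>\<omega>. 8 * (X \<omega> ^ 8 + 1))" and ER: "(\<integral>\<omega>. 8 * (X \<omega> ^ 8 + 1) \<partial>M) \<le> 8 * (k + 1)"
    using int le by (simp_all add: prob_space)
  have dom: "f \<in> L4_space M \<and> (\<integral>\<omega>. f \<omega> ^ 4 \<partial>M) \<le> 8 * (k + 1)"
    if f[measurable]: "f \<in> borel_measurable M" and "\<And>\<omega>. f \<omega> ^ 4 \<le> 8 * (X \<omega> ^ 8 + 1)" for f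
  proof -
    have i: "integrable M (\<lambda>\<omega>. f \<omega> ^ 4)"
    proof (rule Bochner_Integration.integrable_bound[OF intR])
      show "AE \<omega> in M. norm (f \<omega> ^ 4) \<le> norm (8 * (X \<omega> ^ 8 + 1))"
        using that(2) by (intro AE_I2) (simp add: abs_of_nonneg)
    qed measurable
    have "(\<integral>\<omega>. f \<omega> ^ 4 \<partial>M) \<le> (\<integral>\<omega>. 8 * (X \<omega> ^ 8 + 1) \<partial>M)"
      by (rule integral_mono[OF i intR that(2)])
    with ER i f show ?thesis by (simp add: L4_space_def)
  qed
  have "x ^ 4 \<le> 8 * (x ^ 8 + 1)" for x :: real
  proof -
    have *: "x ^ 8 = (x ^ 4)\<^sup>2" by (simp flip: power_mult)
    have "a \<le> 8 * (b + 1)" if "2 * a \<le> b + 1" "0 \<le> b" for a b :: real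
      using that by (simp add: algebra_simps)
    from this[of "x ^ 4" "(x ^ 4)\<^sup>2"] have "x ^ 4 \<le> 8 * ((x ^ 4)\<^sup>2 + 1)"
      using sum_squares_bound[of "x ^ 4" 1] by simp
    then show ?thesis unfolding * .
  qed
  from dom[OF X this] show "X \<in> L4_space M" "(\<integral>\<omega>. X \<omega> ^ 4 \<partial>M) \<le> 8 * (k + 1)" by auto
  have "(x\<^sup>2 - 1) ^ 4 \<le> 8 * (x ^ 8 + 1)" for x :: real
    using add_pow4_le[of "x\<^sup>2" "- 1"] by (simp flip: power_mult)
  from dom[OF _ this] show "(\<lambda>\<omega>. (X \<omega>)\<^sup>2 - 1) \<in> L4_space M" "(\<integral>\<omega>. ((X \<omega>)\<^sup>2 - 1) ^ 4 \<partial>M) \<le> 8 * (k + 1)"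
    by auto
qed

theorem mainTheorem20:
  fixes \<nu> :: "'e::real_normed_vector measure"
    and X :: "nat \<Rightarrow> 'e \<Rightarrow> real"
    and \<mu> :: "real measure"
    and e :: "nat \<Rightarrow> real \<Rightarrow> real"
    and h\<^sub>1 h\<^sub>2 :: "real \<Rightarrow> real"
    and Z :: "real \<Rightarrow> 'e \<Rightarrow> real"
  assumes "prob_space \<nu>" and "space \<nu> = UNIV"
    and "prob_space.indep_vars \<nu> (\<lambda>_. borel) X {1..}"
    and "\<And>k. k \<ge> 1 \<Longrightarrow> integrable \<nu> (X k) \<and> prob_space.expectation \<nu> (X k) = 0"
    and "\<And>k. k \<ge> 1 \<Longrightarrow> prob_space.variance \<nu> (X k) = 1"
    and "\<And>p::real. p > 1 \<Longrightarrow>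
           \<exists>K::real. (SUP k\<in>{1..}. \<integral>\<^sup>+\<omega>. ennreal (\<bar>X k \<omega>\<bar> powr p) \<partial>\<nu>) < ennreal K"
    and "prob_space \<mu>" and "sets \<mu> = sets borel" and "\<And>x. emeasure \<mu> {x} = 0"
    and "hilbert_basis \<mu> e"
    and "h\<^sub>1 \<in> L2_space \<mu>" and "h\<^sub>2 \<in> L2_space \<mu>"
    and "\<And>t. t \<ge> 0 \<Longrightarrow> Z t = Phi_integral \<nu> X \<mu> e h\<^sub>1 (\<lambda>s. h\<^sub>2 s * indicator {0<..t} s)"
  shows "\<exists>Z' :: real \<Rightarrow> 'e \<Rightarrow> real.
           (\<forall>t\<ge>0. Z' t \<in> borel_measurable \<nu>) \<and>
           (\<forall>\<omega>\<in>space \<nu>. continuous_on {0..} (\<lambda>t. Z' t \<omega>)) \<and>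
           (\<forall>t\<ge>0. AE \<omega> in \<nu>. Z' t \<omega> = Z t \<omega>)"
proof -
  interpret nu: prob_space \<nu> by fact
  interpret mu: prob_space \<mu> by fact
  note \<mu> = \<open>sets \<mu> = sets borel\<close>
  obtain k :: real where k: "(SUP j\<in>{1..}. \<integral>\<^sup>+\<omega>. ennreal (\<bar>X j \<omega>\<bar> powr 8) \<partial>\<nu>) < ennreal k"
    using assms(6)[of 8] by auto
  \<comment> \<open>A negative \<open>k\<close> would make the right-hand side of the strict bound
    0.\<close>
  then have k0: "0 \<le> k" by (metis ennreal_neg linorder_le_cases not_less_zero)
  have X_meas: "X j \<in> borel_measurable \<nu>" if "j \<ge> 1" for j
    using assms(4)[OF that] by auto
  have X8: "(\<integral>\<^sup>+\<omega>. ennreal (\<bar>X j \<omega>\<bar> powr 8) \<partial>\<nu>) \<le> ennreal k" if "j \<ge> 1" for j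
  proof -
    have "(\<integral>\<^sup>+\<omega>. ennreal (\<bar>X j \<omega>\<bar> powr 8) \<partial>\<nu>) \<le> (SUP j\<in>{1..}. \<integral>\<^sup>+\<omega>. ennreal (\<bar>X j \<omega>\<bar> powr 8) \<partial>\<nu>)"
      using that by (intro SUP_upper) auto
    with k show ?thesis by simp
  qed
  note X48 = nu.eighth_moment_consequences[OF X_meas X8 k0]
  interpret chaos \<nu> \<mu> X e "8 * (k + 1)"
  proof
    show "nu.indep_vars (\<lambda>_. borel) X {1..}" by fact
    show "1 \<le> 8 * (k + 1)" using k0 by simp
    fix j :: nat assume j: "j \<ge> 1"
    show EX: "(\<integral>\<omega>. X j \<omega> \<partial>\<nu>) = 0" using assms(4)[OF j] by simp
    show "X j \<in> L4_space \<nu>" "(\<integral>\<omega>. X j \<omega> ^ 4 \<partial>\<nu>) \<le> 8 * (k + 1)"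
      "(\<lambda>\<omega>. (X j \<omega>)\<^sup>2 - 1) \<in> L4_space \<nu>" "(\<integral>\<omega>. ((X j \<omega>)\<^sup>2 - 1) ^ 4 \<partial>\<nu>) \<le> 8 * (k + 1)"
      using X48[OF j j] by auto
    have "integrable \<nu> (\<lambda>\<omega>. (X j \<omega>)\<^sup>2)"
      using nu.L4_space_subset_L2(1)[OF X48(1)[OF j j]] by (rule L2_spaceD)
    \<comment> \<open>With mean zero, variance one says that the second moment is 1.\<close>
    then show "(\<integral>\<omega>. (X j \<omega>)\<^sup>2 - 1 \<partial>\<nu>) = 0"
      using assms(5)[OF j] EX by (simp add: nu.prob_space)
    show "e j \<in> L2_space \<mu>" using assms(10) j by (simp add: hilbert_basis_def)
    show "L2_inner \<mu> (e i) (e j) = (if i = j then 1 else 0)" if "i \<ge> 1" for i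
      using assms(10) j that by (simp add: hilbert_basis_def)
  qed
  let ?g = "\<lambda>t x. h\<^sub>2 x * indicator {0<..t} x"
  have g: "?g t \<in> L2_space \<mu>" for t
    by (rule L2_space_mult_indicator[OF assms(12)]) (simp add: \<mu>)
  obtain G where G: "continuous_on UNIV G" "mono G"
    "\<And>s t. 0 \<le> s \<Longrightarrow> 0 \<le> t \<Longrightarrow> L2_inner \<mu> (\<lambda>x. ?g s x - ?g t x) (\<lambda>x. ?g s x - ?g t x) = \<bar>G s - G t\<bar>"
    using diffuse_energy_function[OF \<mu> assms(9,12)] by blast
  \<comment> \<open>The constant of \<open>Phi_integral_diff_fourth_moment\<close> with
    \<open>8 * (k + 1)\<close> in place of \<open>K\<close>; the fixed energy of the integrand is
    absorbed here, and the energy of the integrator increment remains as the increment of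
    \<open>G\<close>.\<close>
  define C where "C = 8 * (4096 * (8 * (k + 1)) ^ 4 + 16 * (8 * (k + 1))\<^sup>2) * (L2_inner \<mu> h\<^sub>1 h\<^sub>1)\<^sup>2"
  have "\<exists>Z' :: real \<Rightarrow> 'e \<Rightarrow> real.
    (\<forall>t\<in>{0..1}. Z' t \<in> borel_measurable \<nu>) \<and>
    (\<forall>\<omega>\<in>space \<nu>. continuous_on {0..1} (\<lambda>t. Z' t \<omega>)) \<and>
    (\<forall>t\<in>{0..1}. AE \<omega> in \<nu>. Z' t \<omega> = Z t \<omega>)"
  proof (rule nu.continuous_modification_time_change[of Z C G])
    show "Z t \<in> borel_measurable \<nu>" if "t \<in> {0..1}" for t
      using assms(13)[of t] Phi_integral_measurable[OF \<mu> assms(11) g] that by simp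
    fix s t :: real assume st: "s \<in> {0..1}" "t \<in> {0..1}"
    have Z: "Z s = Phi_integral \<nu> X \<mu> e h\<^sub>1 (?g s)" "Z t = Phi_integral \<nu> X \<mu> e h\<^sub>1 (?g t)"
      using assms(13) st by auto
    note P = Phi_integral_diff_fourth_moment[OF \<mu> assms(11) g[of s] g[of t], folded Z]
    show "(\<lambda>\<omega>. Z s \<omega> - Z t \<omega>) \<in> L4_space \<nu>" by (rule P(1))
    show "(\<integral>\<omega>. (Z s \<omega> - Z t \<omega>) ^ 4 \<partial>\<nu>) \<le> C * (G s - G t)\<^sup>2"
      using P(2) G(3)[of s t] st unfolding C_def by simp
  next
    show "mono_on {0..1} G" using G(2) by (simp add: mono_on_def mono_def)
    show "continuous_on {0..1} G" using G(1) by (rule continuous_on_subset) simp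
    show "0 \<le> C" unfolding C_def by simp
  qed
  then obtain Z' :: "real \<Rightarrow> 'e \<Rightarrow> real" where Z':
    "\<And>t. t \<in> {0..1} \<Longrightarrow> Z' t \<in> borel_measurable \<nu>"
    "\<And>\<omega>. \<omega> \<in> space \<nu> \<Longrightarrow> continuous_on {0..1} (\<lambda>t. Z' t \<omega>)"
    "\<And>t. t \<in> {0..1} \<Longrightarrow> AE \<omega> in \<nu>. Z' t \<omega> = Z t \<omega>"
    by blast
  \<comment> \<open>Both triangles lie in \<open>[0,1]\<^sup>2\<close>, so the process is constant after time 1.\<close>
  have stop: "Z t = Z (min t 1)" if "t \<ge> 0" for t
  proof -
    have *: "tensor h\<^sub>1 (?g t) z * indicator triangle z = tensor h\<^sub>1 (?g (min t 1)) z * indicator triangle z"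
      "tensor (?g t) h\<^sub>1 z * indicator triangle' z = tensor (?g (min t 1)) h\<^sub>1 z * indicator triangle' z" for z
      by (auto simp: tensor_apply triangle_def triangle'_def indicator_def)
    have "Phi_integral \<nu> X \<mu> e h\<^sub>1 (?g t) = Phi_integral \<nu> X \<mu> e h\<^sub>1 (?g (min t 1))"
      unfolding Phi_integral_def by (simp only: *)
    then show ?thesis using assms(13)[of t] assms(13)[of "min t 1"] that by simp
  qed
  show ?thesis
  proof (intro exI[of _ "\<lambda>t. Z' (min t 1)"] conjI allI impI ballI)
    fix t :: real assume t: "t \<ge> 0"
    then have m: "min t 1 \<in> {0..1}" by auto
    show "Z' (min t 1) \<in> borel_measurable \<nu>" by (rule Z'(1)[OF m])
    show "AE \<omega> in \<nu>. Z' (min t 1) \<omega> = Z t \<omega>" unfolding stop[OF t] by (rule Z'(3)[OF m])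
  next
    fix \<omega> assume "\<omega> \<in> space \<nu>"
    from Z'(2)[OF this] show "continuous_on {0..} (\<lambda>t. Z' (min t 1) \<omega>)"
      by (rule continuous_on_compose2) (auto intro!: continuous_intros)
  qed
qed

end
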